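(* Let $(s_n)_{n\ge1}$ be a sequence of positive real numbers and let $(X,\Sigma,\mu,T^t)$ be an aperiodic dynamical system for which there exists a finite constant $C$ such that for all $f\in L^1(X)$ and all $\gamma>0$ $$\mu\Big(\Big\{x\in X:\ \sup_{N\ge1}\frac1N\sum_{n=1}^N f(T^{s_n}x)\ge\gamma\Big\}\Big)\le\frac C\gamma\int_X|f|\,d\mu.$$ Then the same maximal inequality holds in every dynamical system with the same constant $C$; that is, for every dynamical system $(\tilde X,\beta,\mathfrak m,U^t)$, every $\tilde f\in L^1(\tilde X)$ and every $\gamma>0$, $$\mathfrak m\Big(\Big\{x\in\tilde X:\ \sup_{N\ge1}\frac1N\sum_{n=1}^N \tilde f(U^{s_n}x)\ge\gamma\Big\}\Big)\le\frac C\gamma\int_{\tilde X}|\tilde f|\,d\mathfrak m.$$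
   Context: A Lebesgue probability space $(X,\Sigma,\mu)$ is a complete, countably additive probability space that is measure-theoretically isomorphic to a measurable subset of the unit interval with Lebesgue measure. A flow $\{T^t:t\in\mathbb R\}$ is a group of measurable transformations $T^t:X\to X$ with $T^0(x)=x$ and $T^{t+s}=T^t\circ T^s$ for $s,t\in\mathbb R$. It is measurable if $(x,t)\mapsto T^t(x)$ from $X\times\mathbb R$ to $X$ is measurable with respect to the completion of the product of $\mu$ and Lebesgue measure on $\mathbb R$. It is measure preserving if it is measurable and $\mu((T^t)^{-1}A)=\mu(A)$ for all $A\in\Sigma$ and $t\in\mathbb R$. A dynamical system is a quadruple $(X,\Sigma,\mu,T^t)$ consisting of a Lebesgue probability space and a measure preserving flow on it. It is aperiodic if $\mu\{x: T^t(x)=T^s(x)\text{ for some }t\neq s\}=0$. *)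

theory Defs
  imports "HOL-Probability.Probability"
begin

text \<open>Isomorphism of measure spaces modulo null sets: after discarding a null set on each side
  there is a bimeasurable, measure preserving bijection. Since \<open>\<phi>\<close> is a bijection, quantifying
  over the subsets \<open>A\<close> of the domain covers measurability of both \<open>\<phi>\<close> and its inverse.\<close>

definition measure_isomorphic :: "'a measure \<Rightarrow> 'b measure \<Rightarrow> bool" where
  "measure_isomorphic M N \<longleftrightarrow>
     (\<exists>M0\<in>null_sets M. \<exists>N0\<in>null_sets N. \<exists>\<phi>.
        bij_betw \<phi> (space M - M0) (space N - N0) \<and>
        (\<forall>A. A \<subseteq> space M - M0 \<longrightarrow> (A \<in> sets M \<longleftrightarrow> \<phi> ` A \<in> sets N)) \<and>
        (\<forall>A\<in>sets M. A \<subseteq> space M - M0 \<longrightarrow> emeasure N (\<phi> ` A) = emeasure M A))"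

text \<open>Lebesgue measure on the subset \<open>E\<close> below is not normalised, so \<open>E\<close> necessarily has
  measure \<open>1\<close>.\<close>

locale lebesgue_prob_space = prob_space M + complete_measure M for M :: "'a measure" +
  assumes isomorphic_unit_interval:
    "\<exists>E\<in>sets (lebesgue :: real measure). E \<subseteq> {0..1} \<and> measure_isomorphic M (lebesgue_on E)"

locale flow =
  fixes M :: "'a measure" and T :: "real \<Rightarrow> 'a \<Rightarrow> 'a"
  assumes measurable_transformation: "T t \<in> measurable M M"
    and flow_zero: "x \<in> space M \<Longrightarrow> T 0 x = x"
    and flow_add: "x \<in> space M \<Longrightarrow> T (t + s) x = T t (T s x)"

locale measure_preserving_flow = flow M T
  for M :: "'a measure" and T :: "real \<Rightarrow> 'a \<Rightarrow> 'a" +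
  assumes jointly_measurable:
      "(\<lambda>(x, t). T t x) \<in> measurable (completion (M \<Otimes>\<^sub>M (lebesgue :: real measure))) M"
    and measure_preserving:
      "A \<in> sets M \<Longrightarrow> emeasure M (T t -` A \<inter> space M) = emeasure M A"

locale dynamical_system = lebesgue_prob_space M + measure_preserving_flow M T
  for M :: "'a measure" and T :: "real \<Rightarrow> 'a \<Rightarrow> 'a"

definition aperiodic :: "'a measure \<Rightarrow> (real \<Rightarrow> 'a \<Rightarrow> 'a) \<Rightarrow> bool" where
  "aperiodic M T \<longleftrightarrow> {x \<in> space M. \<exists>t s. t \<noteq> s \<and> T t x = T s x} \<in> null_sets M"

text \<open>The supremum of the averages may be infinite, hence it is taken in the extended reals.
  Only the values \<open>s n\<close> with \<open>n \<ge> 1\<close> matter.\<close>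

definition maximal_average ::
  "(real \<Rightarrow> 'a \<Rightarrow> 'a) \<Rightarrow> (nat \<Rightarrow> real) \<Rightarrow> ('a \<Rightarrow> real) \<Rightarrow> 'a \<Rightarrow> ereal" where
  "maximal_average T s f x =
     (SUP N\<in>{1..}. ereal ((1 / real N) * (\<Sum>n=1..N. f (T (s n) x))))"

definition maximal_inequality ::
  "'a measure \<Rightarrow> (real \<Rightarrow> 'a \<Rightarrow> 'a) \<Rightarrow> (nat \<Rightarrow> real) \<Rightarrow> real \<Rightarrow> bool" where
  "maximal_inequality M T s C \<longleftrightarrow>
     (\<forall>f :: 'a \<Rightarrow> real. integrable M f \<longrightarrow>
       (\<forall>\<gamma>>0. measure M {x \<in> space M. maximal_average T s f x \<ge> ereal \<gamma>}
               \<le> C / \<gamma> * (\<integral>x. \<bar>f x\<bar> \<partial>M)))"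

text \<open>The sets measured above are measurable, so that the default value of \<^const>\<open>measure\<close>
  on non-measurable sets plays no role.\<close>

lemma (in flow) sets_maximal_average_ge:
  assumes "integrable M f"
  shows "{x \<in> space M. maximal_average T s f x \<ge> ereal \<gamma>} \<in> sets M"
proof -
  have [measurable]: "T t \<in> measurable M M" for t
    by (rule measurable_transformation)
  have [measurable]: "f \<in> borel_measurable M"
    using assms by (rule borel_measurable_integrable)
  have [measurable]: "maximal_average T s f \<in> borel_measurable M"
    unfolding maximal_average_def [abs_def] by measurable
  show ?thesis by measurable
qed

end

theory Submission
  imports Defs
begin

text \<open>Calderon's transference argument is carried out directly between the two systems. In an aperiodic
  system there is a set of positive measure to which points do not return during a long time, except
  within one unit of time; it gives a tower on which a measurable height \<open>\<tau>\<close> grows at unit speed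
  along the flow. For each \<open>y\<close> of the second system, the maximal inequality is applied to the
  function \<open>x \<mapsto> f (U\<^bsup>\<tau> x\<^esup> y)\<close> supported on the tower: the averages along \<open>T\<^bsup>s n\<^esup> x\<close> are, away
  from the top, the averages of \<open>f\<close> along \<open>U\<^bsup>s n\<^esup>\<close> at the point \<open>U\<^bsup>\<tau> x\<^esup> y\<close>. Integration over \<open>y\<close>
  removes \<open>\<tau>\<close>, and the loss at the top is negligible for high towers. The tower need not fill
  the space, so that Rokhlin's lemma for flows is avoided.\<close>

section \<open>Completed product measures\<close>

lemma sigma_finite_lebesgue: "sigma_finite_measure (lebesgue :: real measure)"
proof
  show "\<exists>A. countable A \<and> A \<subseteq> sets (lebesgue :: real measure) \<and> \<Union>A = space (lebesgue :: real measure)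
      \<and> (\<forall>a\<in>A. emeasure lebesgue a \<noteq> \<infinity>)"
  proof (intro exI conjI)
    show "\<Union>(range (\<lambda>n::nat. {- real n..real n})) = space (lebesgue :: real measure)"
    proof -
      have "x \<in> \<Union>(range (\<lambda>n::nat. {- real n..real n}))" for x :: real
      proof -
        obtain n where "\<bar>x\<bar> \<le> real n" using real_arch_simple by blast
        then show ?thesis by (auto intro!: exI[of _ n])
      qed
      then show ?thesis by auto
    qed
  qed auto
qed

text \<open>A set in the completion of \<open>N\<close> differs from a set in \<open>N\<close> by
  part of a null set. If null sets pull back to null sets, the preimage of such a set is measurable
  in the completion of \<open>M\<close>.\<close>

lemma measurable_completion_completion:
  assumes "g \<in> measurable M N"
    and "\<And>A. A \<in> null_sets N \<Longrightarrow> g -` A \<inter> space M \<in> null_sets M"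
  shows "g \<in> measurable (completion M) (completion N)"
proof (rule completion.measurable_completion2)
  show g: "g \<in> measurable (completion M) N"
    using assms(1) by (rule measurable_completion)
  show "null_sets N \<subseteq> null_sets (distr (completion M) N g)"
  proof
    fix A assume A: "A \<in> null_sets N"
    from assms(2)[OF A] A g show "A \<in> null_sets (distr (completion M) N g)"
      by (auto simp: null_sets_def emeasure_distr)
  qed
qed

lemma (in complete_measure) borel_measurable_AE_cong:
  assumes g: "g \<in> borel_measurable M" and ae: "AE x in M. f x = g x"
  shows "f \<in> borel_measurable M"
proof (rule measurableI)
  fix A :: "'b set" assume A: "A \<in> sets borel"
  show "f -` A \<inter> space M \<in> sets M"
  proof (rule in_sets_AE)
    show "g -` A \<inter> space M \<in> sets M" using g A by (rule measurable_sets)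
    show "AE x in M. (x \<in> g -` A \<inter> space M) = (x \<in> f -` A \<inter> space M)"
      using ae by eventually_elim auto
  qed auto
qed auto

text \<open>Flows are jointly measurable only for a completed product. Completeness of each factor
  keeps almost all sections and the partial integrals of such functions measurable on the factors
  themselves.\<close>

locale complete_pair = pair_sigma_finite M N + M1: complete_measure M + M2: complete_measure N
  for M :: "'a measure" and N :: "'b measure"
begin

lemma AE_AE:
  assumes "AE z in M \<Otimes>\<^sub>M N. P z"
  shows "AE x in M. AE y in N. P (x, y)" and "AE y in N. AE x in M. P (x, y)"
proof -
  show "AE x in M. AE y in N. P (x, y)" by (rule AE_pair[OF assms])
  \<comment> \<open>\<open>AE_commute\<close> asks for a measurable predicate, so the exceptional
    set is enlarged to a measurable null set \<open>Z\<close>.\<close>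
  from assms obtain Z where Z: "Z \<in> null_sets (M \<Otimes>\<^sub>M N)" "{z \<in> space (M \<Otimes>\<^sub>M N). \<not> P z} \<subseteq> Z"
    by (auto simp: eventually_ae_filter)
  have [measurable]: "Z \<in> sets (M \<Otimes>\<^sub>M N)" using Z by auto
  have "AE z in M \<Otimes>\<^sub>M N. z \<notin> Z" using Z(1) by (rule AE_not_in)
  then have "AE x in M. AE y in N. (x, y) \<notin> Z" by (rule AE_pair)
  then have "AE y in N. AE x in M. (x, y) \<notin> Z"
    by (subst (asm) AE_commute) auto
  moreover have "AE y in N. y \<in> space N" by (rule AE_space)
  ultimately show "AE y in N. AE x in M. P (x, y)"
  proof eventually_elim
    case (elim y)
    from elim(1) AE_space show ?case
      by eventually_elim (use Z(2) elim(2) in \<open>auto simp: space_pair_measure\<close>)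
  qed
qed

text \<open>\<open>k\<close> agrees almost everywhere with a function \<open>k'\<close> measurable
  for the plain product, hence on almost every section in either direction. Tonelli's theorem for
  \<open>k'\<close> then passes to \<open>k\<close>.\<close>

lemma
  fixes k :: "'a \<times> 'b \<Rightarrow> ennreal"
  assumes k: "k \<in> borel_measurable (completion (M \<Otimes>\<^sub>M N))"
  shows AE_measurable_section: "AE x in M. (\<lambda>y. k (x, y)) \<in> borel_measurable N"
    and measurable_nn_integral_completion: "(\<lambda>x. \<integral>\<^sup>+y. k (x, y) \<partial>N) \<in> borel_measurable M"
    and measurable_nn_integral_completion': "(\<lambda>y. \<integral>\<^sup>+x. k (x, y) \<partial>M) \<in> borel_measurable N"
    and Fubini_completion: "(\<integral>\<^sup>+x. (\<integral>\<^sup>+y. k (x, y) \<partial>N) \<partial>M) = (\<integral>\<^sup>+y. (\<integral>\<^sup>+x. k (x, y) \<partial>M) \<partial>N)"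
proof -
  obtain k' where k'[measurable]: "k' \<in> borel_measurable (M \<Otimes>\<^sub>M N)" and "AE z in M \<Otimes>\<^sub>M N. k z = k' z"
    using completion_ex_borel_measurable[OF k] by blast
  note ae = AE_AE[OF this(2)]
  show "AE x in M. (\<lambda>y. k (x, y)) \<in> borel_measurable N"
    using ae(1) AE_space
    by eventually_elim (rule M2.borel_measurable_AE_cong[where g = "\<lambda>y. k' (_, y)"], measurable)
  have 1: "AE x in M. (\<integral>\<^sup>+y. k (x, y) \<partial>N) = (\<integral>\<^sup>+y. k' (x, y) \<partial>N)"
    using ae(1) by eventually_elim (rule nn_integral_cong_AE)
  have 2: "AE y in N. (\<integral>\<^sup>+x. k (x, y) \<partial>M) = (\<integral>\<^sup>+x. k' (x, y) \<partial>M)"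
    using ae(2) by eventually_elim (rule nn_integral_cong_AE)
  show "(\<lambda>x. \<integral>\<^sup>+y. k (x, y) \<partial>N) \<in> borel_measurable M"
    by (rule M1.borel_measurable_AE_cong[OF _ 1]) measurable
  show "(\<lambda>y. \<integral>\<^sup>+x. k (x, y) \<partial>M) \<in> borel_measurable N"
    by (rule M2.borel_measurable_AE_cong[OF _ 2]) measurable
  show "(\<integral>\<^sup>+x. (\<integral>\<^sup>+y. k (x, y) \<partial>N) \<partial>M) = (\<integral>\<^sup>+y. (\<integral>\<^sup>+x. k (x, y) \<partial>M) \<partial>N)"
    unfolding nn_integral_cong_AE[OF 1] nn_integral_cong_AE[OF 2]
    by (rule Fubini[symmetric]) measurable
qed

lemma
  fixes k :: "'a \<times> 'b \<Rightarrow> real"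
  assumes k: "k \<in> borel_measurable (completion (M \<Otimes>\<^sub>M N))"
  shows AE_measurable_section_real: "AE x in M. (\<lambda>y. k (x, y)) \<in> borel_measurable N"
    and AE_measurable_section_real': "AE y in N. (\<lambda>x. k (x, y)) \<in> borel_measurable M"
    and measurable_integral_completion: "(\<lambda>x. \<integral>y. k (x, y) \<partial>N) \<in> borel_measurable M"
proof -
  obtain k' where k'[measurable]: "k' \<in> borel_measurable (M \<Otimes>\<^sub>M N)" and "AE z in M \<Otimes>\<^sub>M N. k z = k' z"
    using completion_ex_borel_measurable_real[OF k] by blast
  note ae = AE_AE[OF this(2)]
  show sec: "AE x in M. (\<lambda>y. k (x, y)) \<in> borel_measurable N"
    using ae(1) AE_space
    by eventually_elim (rule M2.borel_measurable_AE_cong[where g = "\<lambda>y. k' (_, y)"], measurable)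
  show "AE y in N. (\<lambda>x. k (x, y)) \<in> borel_measurable M"
    using ae(2) AE_space
    by eventually_elim (rule M1.borel_measurable_AE_cong[where g = "\<lambda>x. k' (x, _)"], measurable)
  have 1: "AE x in M. (\<integral>y. k (x, y) \<partial>N) = (\<integral>y. k' (x, y) \<partial>N)"
    using ae(1) sec AE_space by eventually_elim (rule integral_cong_AE, auto)
  show "(\<lambda>x. \<integral>y. k (x, y) \<partial>N) \<in> borel_measurable M"
    by (rule M1.borel_measurable_AE_cong[OF _ 1]) measurable
qed

end

section \<open>Distinguishing the points of a Lebesgue space by one real function\<close>

context lebesgue_prob_space
begin

text \<open>This extracts from the isomorphism with a subset of the unit interval one bounded
  function whose values determine the point off a null set. Equality of its values at two times of
  an orbit will thus force equality of the points.\<close>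

lemma separating_function:
  obtains f :: "'a \<Rightarrow> real" and M0 where "f \<in> borel_measurable M" "\<And>x. f x \<in> {0..1}"
    "M0 \<in> null_sets M" "inj_on f (space M - M0)"
proof -
  obtain E where E: "E \<in> sets (lebesgue :: real measure)" "E \<subseteq> {0..1}" "measure_isomorphic M (lebesgue_on E)"
    using isomorphic_unit_interval by blast
  then obtain M0 N0 \<phi> where M0: "M0 \<in> null_sets M" and N0: "N0 \<in> null_sets (lebesgue_on E)"
    and bij: "bij_betw \<phi> (space M - M0) (space (lebesgue_on E) - N0)"
    and iff: "\<And>A. A \<subseteq> space M - M0 \<Longrightarrow> A \<in> sets M \<longleftrightarrow> \<phi> ` A \<in> sets (lebesgue_on E)"
    unfolding measure_isomorphic_def by blast
  \<comment> \<open>The value 0 on \<open>M0\<close> may collide with a value of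
    \<open>\<phi>\<close>; injectivity is claimed only off \<open>M0\<close>.\<close>
  define f where "f x = (if x \<in> space M - M0 then \<phi> x else 0)" for x
  have f01: "f x \<in> {0..1}" for x
    using bij_betw_apply[OF bij, of x] E(2) by (auto simp: f_def)
  have meas: "{x \<in> space M. f x \<in> B} \<in> sets M" if B: "B \<in> sets borel" for B
  proof -
    define A where "A = {x \<in> space M - M0. \<phi> x \<in> B}"
    have "\<phi> ` A = B \<inter> (space (lebesgue_on E) - N0)"
      using bij by (auto simp: A_def bij_betw_def)
    also have "\<dots> = (B \<inter> E) - N0" by auto
    also have "\<dots> \<in> sets (lebesgue_on E)"
      using N0 B E(1) by (intro sets.Diff) (auto simp: sets_restrict_space)
    finally have A: "A \<in> sets M" using iff[of A] by (auto simp: A_def)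
    have "{x \<in> space M. f x \<in> B} = A \<union> (if 0 \<in> B then M0 else {})"
      using null_setsD2[OF M0, THEN sets.sets_into_space] by (auto simp: A_def f_def)
    then show ?thesis using A M0 by auto
  qed
  show thesis
  proof
    show "f \<in> borel_measurable M"
      by (rule measurableI) (use meas in \<open>auto simp: vimage_def Int_def conj_commute\<close>)
    show "inj_on f (space M - M0)"
      using bij by (auto simp: f_def bij_betw_def inj_on_def)
  qed (use f01 M0 in auto)
qed

end

section \<open>Window integrals along an orbit\<close>

lemma integrable_on_unit_valued:
  fixes g :: "real \<Rightarrow> real"
  assumes "g \<in> borel_measurable lebesgue" "\<And>t. g t \<in> {0..1}"
  shows "g integrable_on {a..b}"
proof (rule measurable_bounded_by_integrable_imp_integrable_real)
  show "g \<in> borel_measurable (lebesgue_on {a..b})"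
    using assms(1) by (simp add: measurable_restrict_space1)
  show "(\<lambda>t. 1 :: real) integrable_on {a..b}" by (rule integrable_const_ivl)
qed (use assms(2) in auto)

lemma integral_unit_valued_bounds:
  fixes g :: "real \<Rightarrow> real"
  assumes "g \<in> borel_measurable lebesgue" "\<And>t. g t \<in> {0..1}" "a \<le> b"
  shows "integral {a..b} g \<in> {0..b - a}"
proof -
  note int = integrable_on_unit_valued[OF assms(1,2)]
  have "integral {a..b} g \<le> integral {a..b} (\<lambda>t. 1)"
    using assms(2) by (intro integral_le int) auto
  moreover have "0 \<le> integral {a..b} g"
    using assms(2) by (intro integral_nonneg int) auto
  ultimately show ?thesis using assms(3) by simp
qed

text \<open>For \<open>u \<le> v\<close> the two window integrals differ by the integral over
  \<open>{u..v}\<close> minus that over \<open>{u + r..v + r}\<close>. Both lie between 0 and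
  \<open>v - u\<close>, so the error is not doubled.\<close>

lemma window_integral_Lipschitz:
  fixes g :: "real \<Rightarrow> real"
  assumes g: "g \<in> borel_measurable lebesgue" "\<And>t. g t \<in> {0..1}" and r: "0 \<le> r"
  shows "\<bar>integral {u..u + r} g - integral {v..v + r} g\<bar> \<le> \<bar>u - v\<bar>"
proof (induct u v rule: linorder_wlog)
  case (le u v)
  note int = integrable_on_unit_valued[OF g]
  have "integral {u..v} g + integral {v..v + r} g = integral {u..v + r} g"
    using le r by (intro Henstock_Kurzweil_Integration.integral_combine int) auto
  moreover have "integral {u..u + r} g + integral {u + r..v + r} g = integral {u..v + r} g"
    using le r by (intro Henstock_Kurzweil_Integration.integral_combine int) auto
  moreover have "integral {u..v} g \<in> {0..v - u}" "integral {u + r..v + r} g \<in> {0..v - u}"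
    using integral_unit_valued_bounds[OF g, of u v] integral_unit_valued_bounds[OF g, of "u + r" "v + r"] le
    by auto
  ultimately show ?case using le by auto
qed (simp add: abs_minus_commute)

lemma window_integral_length_bounds:
  fixes g :: "real \<Rightarrow> real"
  assumes g: "g \<in> borel_measurable lebesgue" "\<And>t. g t \<in> {0..1}" and "0 \<le> r" "r \<le> r'"
  shows "integral {u..u + r'} g - integral {u..u + r} g \<in> {0..r' - r}"
proof -
  have "integral {u..u + r} g + integral {u + r..u + r'} g = integral {u..u + r'} g"
    using assms by (intro Henstock_Kurzweil_Integration.integral_combine integrable_on_unit_valued[OF g]) auto
  then show ?thesis using integral_unit_valued_bounds[OF g, of "u + r" "u + r'"] assms by auto
qed

text \<open>By Lebesgue differentiation the window integrals determine \<open>g\<close> almost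
  everywhere: \<open>g (t + u)\<close> and \<open>g t\<close> are derivatives of the same function
  of \<open>t\<close>.\<close>

lemma AE_eq_shift_if_window_integrals_eq:
  fixes g :: "real \<Rightarrow> real"
  assumes g: "g \<in> borel_measurable lebesgue" "\<And>t. g t \<in> {0..1}"
    and eq: "\<And>r. 0 \<le> r \<Longrightarrow> r \<le> 1 \<Longrightarrow> integral {u..u + r} g = integral {0..r} g"
  shows "AE t in lebesgue. t \<in> {0..<1} \<longrightarrow> g (t + u) = g t"
proof -
  note int = integrable_on_unit_valued[OF g]
  obtain N where N: "negligible N" and
    lim: "\<And>x e. \<lbrakk>x \<notin> N; 0 < e\<rbrakk> \<Longrightarrow> \<exists>d>0. \<forall>h. 0 < h \<and> h < d \<longrightarrow>
                 norm (integral (cbox x (x + h *\<^sub>R One)) g /\<^sub>R h ^ DIM(real) - g x) < e"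
    using integrable_ccontinuous_explicit[of g] int by (auto simp: cbox_interval)
  have N': "negligible ((\<lambda>t. - u + t) ` N)"
    using N by (rule negligible_translation)
  have "t \<in> {0..<1} \<longrightarrow> g (t + u) = g t" if t: "t \<notin> N \<union> (\<lambda>t. - u + t) ` N" for t
  proof
    assume t01: "t \<in> {0..<1}"
    have tu: "t + u \<notin> N" "t \<notin> N" using t by (auto simp: image_iff algebra_simps)
    show "g (t + u) = g t"
    proof (rule ccontr)
      assume "g (t + u) \<noteq> g t"
      then have e: "\<bar>g (t + u) - g t\<bar> / 2 > 0" by simp
      have lim': "\<exists>d>0. \<forall>h. 0 < h \<and> h < d \<longrightarrow>
          \<bar>integral {x..x + h} g / h - g x\<bar> < \<bar>g (t + u) - g t\<bar> / 2" if "x \<notin> N" for x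
      proof -
        have "integral (cbox x (x + h *\<^sub>R One)) g /\<^sub>R h ^ DIM(real) = integral {x..x + h} g / h" for h
          by (simp add: cbox_interval divide_real_def)
        with lim[OF that e] show ?thesis by (simp only: real_norm_def)
      qed
      obtain d1 where d1: "d1 > 0" and 1: "\<And>h. 0 < h \<Longrightarrow> h < d1 \<Longrightarrow>
          \<bar>integral {t..t + h} g / h - g t\<bar> < \<bar>g (t + u) - g t\<bar> / 2"
        using lim'[OF tu(2)] by blast
      obtain d2 where d2: "d2 > 0" and 2: "\<And>h. 0 < h \<Longrightarrow> h < d2 \<Longrightarrow>
          \<bar>integral {t + u..t + u + h} g / h - g (t + u)\<bar> < \<bar>g (t + u) - g t\<bar> / 2"
        using lim'[OF tu(1)] by blast
      \<comment> \<open>This \<open>h\<close> serves both difference quotients at once and keeps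
        \<open>t + h\<close> within the range where \<open>eq\<close> applies.\<close>
      define h where "h = min (min d1 d2) (1 - t) / 2"
      have h: "0 < h" "h < d1" "h < d2" "t + h \<le> 1"
        using d1 d2 t01 by (auto simp: h_def min_def field_simps)
      have "integral {u..u + t} g + integral {u + t..u + (t + h)} g = integral {u..u + (t + h)} g"
        using t01 h by (intro Henstock_Kurzweil_Integration.integral_combine int) auto
      moreover have "integral {0..t} g + integral {t..t + h} g = integral {0..t + h} g"
        using t01 h by (intro Henstock_Kurzweil_Integration.integral_combine int) auto
      moreover have "integral {u..u + t} g = integral {0..t} g"
        "integral {u..u + (t + h)} g = integral {0..t + h} g"
        using eq[of t] eq[of "t + h"] t01 h by auto
      ultimately have "integral {t + u..t + u + h} g = integral {t..t + h} g"
        by (simp add: algebra_simps)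
      with 1[OF h(1,2)] 2[OF h(1,3)] show False by (smt (verit, best) field_sum_of_halves)
    qed
  qed
  moreover have "AE t in lebesgue. t \<notin> N \<union> (\<lambda>t. - u + t) ` N"
    using N N' by (intro AE_not_in) (auto simp: negligible_iff_null_sets)
  ultimately show ?thesis by (auto elim: eventually_mono)
qed

text \<open>A compactness argument: the window integrals at the points \<open>j / J\<close> form a 1-Lipschitz function
  of the base point \<open>u\<close>.\<close>

lemma window_integrals_separate:
  fixes g :: "real \<Rightarrow> real"
  assumes g: "g \<in> borel_measurable lebesgue" "\<And>t. g t \<in> {0..1}"
    and sep: "\<And>u. u \<in> {a..b} \<Longrightarrow> \<not> (AE t in lebesgue. t \<in> {0..<1} \<longrightarrow> g (t + u) = g t)"
  obtains n :: nat where
    "\<And>u. u \<in> {a..b} \<Longrightarrow> \<exists>j\<le>Suc n. 1 / Suc n < \<bar>integral {u..u + j / Suc n} g - integral {0..j / Suc n} g\<bar>"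
proof (rule ccontr)
  assume "\<not> thesis"
  then have "\<forall>n. \<exists>u\<in>{a..b}. \<forall>j\<le>Suc n. \<bar>integral {u..u + j / Suc n} g - integral {0..j / Suc n} g\<bar> \<le> 1 / Suc n"
    using that by (meson not_less)
  then obtain u where u: "\<And>n. u n \<in> {a..b}" and
    close: "\<And>n j. j \<le> Suc n \<Longrightarrow> \<bar>integral {u n..u n + j / Suc n} g - integral {0..j / Suc n} g\<bar> \<le> 1 / Suc n"
    by metis
  have "compact {a..b}" by (rule compact_Icc)
  then obtain l \<sigma> where l: "l \<in> {a..b}" and \<sigma>: "strict_mono (\<sigma> :: nat \<Rightarrow> nat)" and lim: "(u \<circ> \<sigma>) \<longlonglongrightarrow> l"
    using u unfolding compact_def by metis
  have "integral {l..l + r} g = integral {0..r} g" if r: "0 \<le> r" "r \<le> 1" for r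
  proof -
    \<comment> \<open>The Lipschitz bound costs \<open>\<bar>l - u n\<bar>\<close>. Rounding
      \<open>r\<close> down to the grid point \<open>q\<close> costs \<open>1 / Suc n\<close> for
      each of the two windows, and \<open>close\<close> adds one more.\<close>
    have bound: "\<bar>integral {l..l + r} g - integral {0..r} g\<bar> \<le> \<bar>l - u n\<bar> + 3 / Suc n" for n
    proof -
      define j where "j = nat \<lfloor>r * Suc n\<rfloor>"
      define J where "J = real (Suc n)"
      define q where "q = j / J"
      have J: "J > 0" by (simp add: J_def)
      have "0 \<le> r * J" using r J by simp
      then have jr: "real j \<le> r * J" "r * J < real j + 1"
        unfolding j_def J_def by linarith+
      have "q \<le> r" "0 \<le> q" using jr(1) J by (simp_all add: q_def pos_divide_le_eq)
      moreover have "r < (real j + 1) / J" using jr(2) J by (simp add: pos_less_divide_eq)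
      then have "r - q \<le> 1 / J" by (simp add: q_def add_divide_distrib)
      ultimately have q: "q \<le> r" "r - q \<le> 1 / J" "0 \<le> q" by auto
      have "r * J \<le> 1 * J" using r J by (intro mult_right_mono) auto
      with jr(1) have "real j \<le> J" by linarith
      then have "j \<le> Suc n" unfolding J_def of_nat_le_iff .
      then have "\<bar>integral {u n..u n + q} g - integral {0..q} g\<bar> \<le> 1 / J"
        using close[of j n] by (simp only: q_def J_def)
      moreover have "integral {u n..u n + r} g - integral {u n..u n + q} g \<in> {0..r - q}"
        using q by (intro window_integral_length_bounds[OF g])
      moreover have "integral {0..0 + r} g - integral {0..0 + q} g \<in> {0..r - q}"
        using q by (intro window_integral_length_bounds[OF g])
      moreover have "\<bar>integral {l..l + r} g - integral {u n..u n + r} g\<bar> \<le> \<bar>l - u n\<bar>"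
        using r by (intro window_integral_Lipschitz[OF g])
      ultimately show ?thesis using q(2) unfolding J_def[symmetric] by auto
    qed
    have "(\<lambda>n. \<bar>l - (u \<circ> \<sigma>) n\<bar> + 3 * (1 / Suc (\<sigma> n))) \<longlonglongrightarrow> \<bar>l - l\<bar> + 3 * 0"
      by (intro tendsto_intros lim LIMSEQ_subseq_LIMSEQ[OF LIMSEQ_Suc[OF lim_1_over_n] \<sigma>, unfolded o_def])
    then have "\<bar>integral {l..l + r} g - integral {0..r} g\<bar> \<le> \<bar>l - l\<bar> + 3 * 0"
      by (rule LIMSEQ_le_const) (use bound in auto)
    then show ?thesis by simp
  qed
  then have "AE t in lebesgue. t \<in> {0..<1} \<longrightarrow> g (t + l) = g t"
    by (intro AE_eq_shift_if_window_integrals_eq[OF g]) auto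
  with sep[OF l] show False by blast
qed

section \<open>Separated sets of an aperiodic flow\<close>

lemma complete_pair_lebesgueI: "prob_space M \<Longrightarrow> complete_measure M \<Longrightarrow> complete_pair M (lebesgue :: real measure)"
  by (intro complete_pair.intro pair_sigma_finite.intro sigma_finite_lebesgue
      prob_space_imp_sigma_finite completion.complete_measure_axioms)

lemma AE_lebesgue_translate:
  fixes P :: "real \<Rightarrow> bool"
  assumes "AE t in lebesgue. P t"
  shows "AE t in lebesgue. P (t + u)"
proof -
  obtain N where N: "negligible N" "{t. \<not> P t} \<subseteq> N"
    using assms by (auto simp: eventually_ae_filter negligible_iff_null_sets)
  have "negligible ((\<lambda>t. - u + t) ` N)" using N(1) by (rule negligible_translation)
  then have "AE t in lebesgue. t \<notin> (\<lambda>t. - u + t) ` N"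
    by (intro AE_not_in) (simp add: negligible_iff_null_sets)
  then show ?thesis
  proof eventually_elim
    case (elim t)
    then have "t + u \<notin> N" by (auto simp: image_iff)
    then show ?case using N(2) by auto
  qed
qed

section \<open>Time that orbits spend in a set\<close>

context dynamical_system
begin

sublocale orbit: complete_pair M "lebesgue :: real measure"
  by (rule complete_pair_lebesgueI) unfold_locales

lemma T_space: "x \<in> space M \<Longrightarrow> T t x \<in> space M"
  using measurable_space[OF measurable_transformation] .

lemma measurable_along_orbit:
  "h \<in> measurable M L \<Longrightarrow> (\<lambda>z. h (T (snd z) (fst z))) \<in> measurable (completion (M \<Otimes>\<^sub>M (lebesgue :: real measure))) L"
  using measurable_compose[OF jointly_measurable] by (auto simp: case_prod_beta')

lemma measurable_snd_completion:
  "h \<in> measurable N L \<Longrightarrow> (\<lambda>z. h (snd z)) \<in> measurable (completion (M \<Otimes>\<^sub>M N)) L"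
  by (intro measurable_completion measurable_compose[OF measurable_snd])

lemma nn_integral_T:
  assumes [measurable]: "h \<in> borel_measurable M"
  shows "(\<integral>\<^sup>+x. h (T t x) \<partial>M) = (\<integral>\<^sup>+x. h x \<partial>M)"
proof -
  have "distr M M (T t) = M"
    using measure_preserving measurable_transformation
    by (intro measure_eqI) (auto simp: emeasure_distr)
  then show ?thesis
    using nn_integral_distr[OF measurable_transformation, of h t] by simp
qed

text \<open>At a fixed time \<open>t\<close> the points with \<open>T t x\<close> in
  \<open>A\<close> have measure \<open>emeasure M A\<close> by invariance, and Fubini's theorem
  exchanges time and space.\<close>

lemma occupation_time:
  assumes A[measurable]: "A \<in> sets M" and B: "B \<in> sets lebesgue"
  shows "(\<integral>\<^sup>+x. (\<integral>\<^sup>+t. indicator B t * indicator A (T t x) \<partial>lebesgue) \<partial>M) = emeasure M A * emeasure lebesgue B"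
proof -
  have "(\<lambda>z. indicator B (snd z) * indicator A (T (snd z) (fst z)) :: ennreal)
      \<in> borel_measurable (completion (M \<Otimes>\<^sub>M lebesgue))"
    by (intro borel_measurable_times_ennreal measurable_along_orbit[of "indicator A"]
        measurable_snd_completion[of "indicator B"]) (use B in auto)
  from orbit.Fubini_completion[OF this]
  have "(\<integral>\<^sup>+x. (\<integral>\<^sup>+t. indicator B t * indicator A (T t x) \<partial>lebesgue) \<partial>M) =
      (\<integral>\<^sup>+t. (\<integral>\<^sup>+x. indicator B t * indicator A (T t x) \<partial>M) \<partial>lebesgue)" by simp
  also have "\<dots> = (\<integral>\<^sup>+t. indicator B t * emeasure M A \<partial>lebesgue)"
  proof (rule nn_integral_cong)
    fix t
    have [measurable]: "T t \<in> measurable M M" by (rule measurable_transformation)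
    show "(\<integral>\<^sup>+x. indicator B t * indicator A (T t x) \<partial>M) = indicator B t * emeasure M A"
      using nn_integral_T[of "indicator A" t] by (subst nn_integral_cmult) auto
  qed
  also have "\<dots> = emeasure M A * emeasure lebesgue B"
    using B by (subst nn_integral_multc) (auto simp: mult.commute)
  finally show ?thesis .
qed

text \<open>The mean time spent in \<open>M0\<close> is \<open>0 * \<infinity>\<close>, which is 0
  in the extended nonnegative reals.\<close>

lemma AE_orbit_notin_null:
  assumes "M0 \<in> null_sets M"
  shows "AE x in M. AE t in lebesgue. T t x \<notin> M0"
proof -
  have [measurable]: "M0 \<in> sets M" using assms by auto
  let ?k = "\<lambda>z. indicator M0 (T (snd z) (fst z)) :: ennreal"
  have k: "?k \<in> borel_measurable (completion (M \<Otimes>\<^sub>M lebesgue))"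
    by (intro measurable_along_orbit) measurable
  have "(\<integral>\<^sup>+x. (\<integral>\<^sup>+t. ?k (x, t) \<partial>lebesgue) \<partial>M) = 0"
    using occupation_time[of M0 UNIV] null_setsD1[OF assms] by simp
  then have "AE x in M. (\<integral>\<^sup>+t. ?k (x, t) \<partial>lebesgue) = 0"
    by (subst (asm) nn_integral_0_iff_AE[OF orbit.measurable_nn_integral_completion[OF k]])
  then show ?thesis using orbit.AE_measurable_section[OF k]
  proof eventually_elim
    case (elim x)
    then have "AE t in lebesgue. ?k (x, t) = 0" by (subst (asm) nn_integral_0_iff_AE) auto
    then show ?case by eventually_elim (auto split: split_indicator_asm)
  qed
qed

lemma AE_measurable_visits:
  assumes [measurable]: "A \<in> sets M"
  shows "AE x in M. {t. T t x \<in> A} \<in> sets lebesgue"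
proof -
  have "(\<lambda>z. indicator A (T (snd z) (fst z)) :: ennreal) \<in> borel_measurable (completion (M \<Otimes>\<^sub>M lebesgue))"
    by (intro measurable_along_orbit) measurable
  from orbit.AE_measurable_section[OF this] show ?thesis
  proof eventually_elim
    case (elim x)
    from measurable_sets[OF elim, of "{1}"] show ?case
      by (auto simp: vimage_def indicator_eq_1_iff)
  qed
qed

lemma null_sets_AE_complement: "(AE x in M. P x) \<Longrightarrow> {x \<in> space M. P x} \<in> sets M"
  using AE_iff_null_sets[of P] sets.compl_sets[of "{x \<in> space M. \<not> P x}" M]
  by (auto simp: set_diff_eq Int_def conj_commute cong: conj_cong elim!: back_subst[of "\<lambda>A. A \<in> sets M"] dest: null_setsD2)

text \<open>The set \<open>A\<close> consists of points whose window integrals \<open>\<integral>\<^sub>0\<^sup>r f (T\<^sup>t x) dt\<close> lie in one small cube,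
  but whose window integrals leave that cube at all times of \<open>[1, L]\<close>.\<close>

lemma separated_set:
  assumes ap: "aperiodic M T"
  obtains A where "A \<in> sets M" "emeasure M A > 0"
    "\<And>x t. x \<in> A \<Longrightarrow> T t x \<in> A \<Longrightarrow> \<bar>t\<bar> \<le> L \<Longrightarrow> \<bar>t\<bar> < 1"
proof -
  obtain f M0 where f[measurable]: "f \<in> borel_measurable M" and f01: "\<And>x. f x \<in> {0..1::real}"
    and M0: "M0 \<in> null_sets M" and inj: "inj_on f (space M - M0)"
    using separating_function by blast
  define g where "g x t = f (T t x)" for x t
  \<comment> \<open>These are the demands on a single orbit: a measurable trace of \<open>f\<close>,
    almost all times at points that \<open>f\<close> separates, and no period.\<close>
  define good where "good x \<longleftrightarrow> g x \<in> borel_measurable lebesgue \<and>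
      (AE t in lebesgue. T t x \<notin> M0) \<and> \<not> (\<exists>t s. t \<noteq> s \<and> T t x = T s x)" for x
  define G where "G = {x \<in> space M. good x}"
  have "AE x in M. g x \<in> borel_measurable lebesgue"
    using orbit.AE_measurable_section_real[OF measurable_along_orbit[OF f]] by (simp add: g_def[abs_def])
  moreover have "AE x in M. \<not> (\<exists>t s. t \<noteq> s \<and> T t x = T s x)"
    using ap by (auto simp: aperiodic_def AE_iff_null_sets)
  ultimately have AE_good: "AE x in M. good x"
    using AE_orbit_notin_null[OF M0] by eventually_elim (simp add: good_def)
  then have G[measurable]: "G \<in> sets M" unfolding G_def by (rule null_sets_AE_complement)
  have emG: "emeasure M G = 1"
    using AE_good by (auto simp: G_def intro!: emeasure_eq_1_AE null_sets_AE_complement)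
  \<comment> \<open>As a Lebesgue integral, \<open>I\<close> is measurable in \<open>x\<close> by
    Fubini's theorem; \<open>I_T\<close> identifies it with a gauge integral over a window of the
    trace.\<close>
  define I where "I x r = (\<integral>t. indicator {0..r} t * f (T t x) \<partial>lebesgue)" for x and r :: real
  have I[measurable]: "(\<lambda>x. I x r) \<in> borel_measurable M" for r
  proof -
    have "(\<lambda>z. indicator {0..r} (snd z) * f (T (snd z) (fst z))) \<in> borel_measurable (completion (M \<Otimes>\<^sub>M lebesgue))"
      by (intro borel_measurable_times measurable_along_orbit[OF f]
          measurable_snd_completion[of "indicator {0..r}"] borel_measurable_indicator) simp
    from orbit.measurable_integral_completion[OF this] show ?thesis by (simp add: I_def[abs_def])
  qed
  have I_T: "I (T u x) r = integral {u..u + r} (g x)" if "x \<in> G" for u x r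
  proof -
    have gx: "g x \<in> borel_measurable lebesgue" "\<And>t. g x t \<in> {0..1}" and x: "x \<in> space M"
      using that f01 by (auto simp: G_def good_def g_def)
    have "I (T u x) r = (\<integral>t. indicator {u..u + r} (u + t) * g x (u + t) \<partial>lebesgue)"
      unfolding I_def g_def
      by (intro Bochner_Integration.integral_cong)
        (auto simp: flow_add[OF x, symmetric] add.commute split: split_indicator)
    also have "\<dots> = (\<integral>t. indicator {u..u + r} t * g x t \<partial>lebesgue)"
      using lebesgue_integral_real_affine[of 1 "\<lambda>t. indicator {u..u + r} t * g x t" u] by simp
    also have "\<dots> = integral {u..u + r} (g x)"
      using set_lebesgue_integral_eq_integral(2)[of "{u..u + r}" "g x"]
        nonnegative_absolutely_integrable_1[OF integrable_on_unit_valued[OF gx]] gx(2)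
      by (simp add: set_lebesgue_integral_def)
    finally show ?thesis .
  qed
  have I_0: "I x r = integral {0..r} (g x)" if "x \<in> G" for x r
    using I_T[OF that, of 0 r] that flow_zero by (simp add: G_def)
  \<comment> \<open>Only rational \<open>u\<close> are tested, which makes \<open>E n\<close>
    measurable. The interval \<open>{1/2..L + 1}\<close> is wider than \<open>{1..L}\<close> and
    leaves room for rational times near any time of the latter.\<close>
  define E where "E n = {x \<in> G. \<forall>u\<in>\<rat> \<inter> {1/2..L + 1}. \<exists>j\<in>{..Suc n}.
      1 / Suc n < \<bar>I (T u x) (j / Suc n) - I x (j / Suc n)\<bar>}" for n :: nat
  have E_sets[measurable]: "E n \<in> sets M" for n
  proof -
    have [measurable]: "T u \<in> measurable M M" for u by (rule measurable_transformation)
    have [simp]: "countable (\<rat> \<inter> {1/2..L + 1})" by (simp add: countable_Int1 countable_rat)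
    have "E n = {x \<in> space M. x \<in> G \<and> (\<forall>u\<in>\<rat> \<inter> {1/2..L + 1}. \<exists>j\<in>{..Suc n}.
      1 / Suc n < \<bar>I (T u x) (j / Suc n) - I x (j / Suc n)\<bar>)}"
      by (auto simp: E_def G_def)
    also have "\<dots> \<in> sets M" by measurable
    finally show ?thesis .
  qed
  have "G = (\<Union>n. E n)"
  proof (intro equalityI subsetI)
    fix x assume x: "x \<in> G"
    then have gx: "g x \<in> borel_measurable lebesgue" "\<And>t. g x t \<in> {0..1}" and xs: "x \<in> space M"
      and M0: "AE t in lebesgue. T t x \<notin> M0"
      and per: "\<And>t s. T t x = T s x \<Longrightarrow> t = s"
      using f01 by (auto simp: G_def good_def g_def)
    \<comment> \<open>If the trace repeated after \<open>u\<close>, separation by \<open>f\<close>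
      would give \<open>T (t + u) x = T t x\<close> for almost every \<open>t\<close> in
      \<open>{0..<1}\<close>. This interval is not null, so \<open>u \<ge> 1/2\<close> would be a
      period.\<close>
    have "\<not> (AE t in lebesgue. t \<in> {0..<1} \<longrightarrow> g x (t + u) = g x t)" if u: "u \<in> {1/2..L + 1}" for u
    proof
      assume "AE t in lebesgue. t \<in> {0..<1} \<longrightarrow> g x (t + u) = g x t"
      with M0 AE_lebesgue_translate[OF M0, of u]
      have "AE t in lebesgue. t \<notin> {0..<1::real}"
      proof eventually_elim
        case (elim t)
        show ?case
        proof
          assume "t \<in> {0..<1}"
          with elim have "T (t + u) x = T t x"
            by (intro inj_onD[OF inj]) (auto simp: g_def xs T_space)
          from per[OF this] u show False by simp
        qed
      qed
      then have "{0..<1::real} \<in> null_sets lebesgue"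
        by (simp add: completion.null_sets_iff_AE)
      then show False by (auto simp: null_sets_def)
    qed
    then obtain n where n: "\<And>u. u \<in> {1/2..L + 1} \<Longrightarrow>
        \<exists>j\<le>Suc n. 1 / Suc n < \<bar>integral {u..u + j / Suc n} (g x) - integral {0..j / Suc n} (g x)\<bar>"
      using window_integrals_separate[OF gx, of "1/2" "L + 1"] by blast
    have "x \<in> E n"
      unfolding E_def using x n by (auto simp only: I_T[OF x] I_0[OF x] mem_Collect_eq atMost_iff Int_iff Bex_def)
    then show "x \<in> (\<Union>n. E n)" by blast
  qed (auto simp: E_def)
  with emG have "emeasure M (\<Union>n. E n) \<noteq> 0" by simp
  then obtain n where n: "emeasure M (E n) \<noteq> 0"
    using emeasure_UN_eq_0[of M E, OF _ image_subsetI, OF _ E_sets] by blast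
  define J where "J = real (Suc n)"
  have J: "J > 0" by (simp add: J_def)
  \<comment> \<open>Rounding splits \<open>E n\<close> into countably many pieces. Corresponding
    window integrals of two points in one piece differ by less than \<open>1 / J\<close>, the
    threshold in \<open>E n\<close>.\<close>
  define code where "code x = map (\<lambda>j. \<lfloor>J * I x (real j / J)\<rfloor>) [0..<Suc (Suc n)]" for x
  define A where "A c = {x \<in> space M. x \<in> E n \<and> length c = Suc (Suc n) \<and>
      (\<forall>j<Suc (Suc n). \<lfloor>J * I x (real j / J)\<rfloor> = c ! j)}" for c
  have A_code: "A c = {x \<in> E n. code x = c}" for c
    by (auto simp: A_def code_def list_eq_iff_nth_eq E_def G_def simp del: upt_Suc)
  have A_sets: "A c \<in> sets M" for c unfolding A_def by measurable
  have "E n = (\<Union>c. A (from_nat c))"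
    by (auto simp: A_code) (metis from_nat_to_nat)
  then obtain c where c: "emeasure M (A (from_nat c)) \<noteq> 0"
    using n emeasure_UN_eq_0[of M "\<lambda>c. A (from_nat c)", OF _ image_subsetI, OF _ A_sets] by metis
  have no_return: False if x: "x \<in> A d" "T t x \<in> A d" and t: "1 \<le> t" "t \<le> L" for x t d
  proof -
    have xE: "x \<in> E n" and xG: "x \<in> G" using x by (auto simp: A_def E_def)
    define W where "W u j = \<bar>I (T u x) (real j / J) - I x (real j / J)\<bar>" for u and j :: nat
    have gx: "g x \<in> borel_measurable lebesgue" "\<And>t. g x t \<in> {0..1}"
      using xG f01 by (auto simp: G_def good_def g_def)
    have W_Lip: "W u j \<le> W t j + \<bar>u - t\<bar>" for u j
      unfolding W_def I_T[OF xG] using window_integral_Lipschitz[OF gx, of "real j / J" u t] J by auto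
    have W: "W t j < 1 / J" if "j \<le> Suc n" for j
    proof -
      have "\<lfloor>J * I (T t x) (real j / J)\<rfloor> = \<lfloor>J * I x (real j / J)\<rfloor>"
        using x that by (simp add: A_def)
      then have "\<bar>J * I (T t x) (real j / J) - J * I x (real j / J)\<bar> < 1" by linarith
      then have "J * W t j < 1"
        using J by (simp add: W_def right_diff_distrib[symmetric] abs_mult)
      then show ?thesis using J by (simp add: pos_less_divide_eq mult.commute)
    qed
    \<comment> \<open>The maximum over finitely many grid points leaves a positive gap below
      \<open>1 / J\<close>. By \<open>W_Lip\<close>, a rational \<open>u\<close> closer to
      \<open>t\<close> than this gap keeps every \<open>W u j\<close> below \<open>1 / J\<close>,
      against membership in \<open>E n\<close>. The cap \<open>1/2\<close> keeps \<open>u\<close>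
      below \<open>L + 1\<close>.\<close>
    define d' where "d' = min (1/2) (1 / J - Max (W t ` {..Suc n}))"
    have "Max (W t ` {..Suc n}) < 1 / J" using W by (subst Max_less_iff) auto
    then have d': "d' > 0" by (simp add: d'_def)
    obtain u where u: "u \<in> \<rat>" "t < u" "u < t + d'" using Rats_dense_in_real[of t "t + d'"] d' by auto
    then have "u \<in> \<rat> \<inter> {1/2..L + 1}" using t by (auto simp: d'_def min_def split: if_splits)
    with xE obtain j where j: "j \<le> Suc n" "1 / J < W u j"
      by (auto simp only: E_def J_def W_def mem_Collect_eq Ball_def Bex_def atMost_iff)
    have "W t j \<le> Max (W t ` {..Suc n})" using j(1) by (intro Max_ge) auto
    with W_Lip[of u j] j(2) u show False by (auto simp: d'_def min_def split: if_splits)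
  qed
  show thesis
  proof
    let ?A = "A (from_nat c)"
    show "?A \<in> sets M" "emeasure M ?A > 0" using c A_sets by (auto simp: zero_less_iff_neq_zero)
    show "\<bar>t\<bar> < 1" if x: "x \<in> ?A" "T t x \<in> ?A" "\<bar>t\<bar> \<le> L" for x t
    proof (rule ccontr)
      assume "\<not> \<bar>t\<bar> < 1"
      then consider "1 \<le> t" | "1 \<le> - t" by linarith
      then show False
      proof cases
        case 1
        then show False using no_return[OF x(1,2)] x(3) by auto
      next
        \<comment> \<open>A return after a negative time is a return of \<open>T t x\<close> to
          \<open>x\<close> after the positive time \<open>- t\<close>.\<close>
        case 2
        have "x \<in> space M" using x(1) by (simp add: A_def)
        then have "T (- t) (T t x) = x" using flow_add[of x "- t" t] flow_zero by simp
        then show False using no_return[OF x(2), of "- t"] x(1,3) 2 by auto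
      qed
    qed
  qed
qed

end

section \<open>Towers\<close>

text \<open>A height outside \<open>{0..<H}\<close> marks a point off the tower. Negative
  \<open>u\<close> are included, so that points can be moved down as well as up.\<close>

locale flow_tower = dynamical_system M T for M :: "'a measure" and T +
  fixes \<tau> :: "'a \<Rightarrow> real" and H :: real
  assumes height_measurable[measurable]: "\<tau> \<in> borel_measurable M"
    and height_flow: "x \<in> space M \<Longrightarrow> 0 \<le> \<tau> x \<Longrightarrow> \<tau> x < H \<Longrightarrow> 0 \<le> \<tau> x + u \<Longrightarrow> \<tau> x + u < H
      \<Longrightarrow> \<tau> (T u x) = \<tau> x + u"

context dynamical_system
begin

text \<open>The height \<open>\<tau> x\<close> is minus the barycentre of the times at which \<open>x\<close> visits the separated set;
  these form a single cluster of diameter at most \<open>1\<close>, so the barycentre moves with the flow.\<close>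

lemma ex_flow_tower:
  assumes ap: "aperiodic M T" and H: "H > 3"
  obtains \<tau> where "flow_tower M T \<tau> H" "emeasure M {x \<in> space M. 0 \<le> \<tau> x \<and> \<tau> x < H} > 0"
proof -
  \<comment> \<open>\<open>2 * H + 2\<close> is the largest distance between a time in the window
    \<open>{- H - 1..1}\<close> and a time in \<open>{- 2 * H - 1..H + 1}\<close>, the range
    occurring in \<open>near\<close>.\<close>
  obtain A where A[measurable]: "A \<in> sets M" and A_pos: "emeasure M A > 0"
    and sep: "\<And>x t. x \<in> A \<Longrightarrow> T t x \<in> A \<Longrightarrow> \<bar>t\<bar> \<le> 2 * H + 2 \<Longrightarrow> \<bar>t\<bar> < 1"
    using separated_set[OF ap] by blast
  define V where "V x = {t. T t x \<in> A}" for x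
  \<comment> \<open>Inside the tower the barycentre lies in \<open>{- H<..0}\<close>; the margin of
    1 on both sides keeps the cluster around it from being truncated.\<close>
  define B where "B x = V x \<inter> {- H - 1..1}" for x
  define w :: "'a \<Rightarrow> real" where "w x = (\<integral>t. indicator {- H - 1..1} t * indicator A (T t x) \<partial>lebesgue)" for x
  define m :: "'a \<Rightarrow> real" where "m x = (\<integral>t. (t * indicator {- H - 1..1} t) * indicator A (T t x) \<partial>lebesgue)" for x
  define G where "G = {x \<in> space M. V x \<in> sets lebesgue}"
  \<comment> \<open>The value \<open>- 1\<close> puts points without a usable cluster off the
    tower.\<close>
  define \<tau> where "\<tau> x = (if x \<in> G \<and> 0 < w x then - (m x / w x) else - 1)" for x
  have AE_G: "AE x in M. x \<in> G"
    using AE_measurable_visits[OF A] AE_space by eventually_elim (simp add: G_def V_def)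
  have [measurable]: "G \<in> sets M"
    unfolding G_def V_def by (rule null_sets_AE_complement[OF AE_measurable_visits[OF A]])
  have indA: "(\<lambda>z. indicator A (T (snd z) (fst z)) :: real) \<in> borel_measurable (completion (M \<Otimes>\<^sub>M lebesgue))"
    by (intro measurable_along_orbit) measurable
  have mk: "(\<lambda>x. \<integral>t. h t * indicator A (T t x) \<partial>lebesgue) \<in> borel_measurable M"
    if "h \<in> borel_measurable borel" for h :: "real \<Rightarrow> real"
  proof -
    have h: "h \<in> borel_measurable lebesgue" using that by (intro measurable_completion) simp
    have "(\<lambda>z. h (snd z) * indicator A (T (snd z) (fst z))) \<in> borel_measurable (completion (M \<Otimes>\<^sub>M lebesgue))"
      by (intro borel_measurable_times indA measurable_snd_completion h)
    from orbit.measurable_integral_completion[OF this] show ?thesis by simp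
  qed
  have [measurable]: "w \<in> borel_measurable M" unfolding w_def[abs_def] by (intro mk) measurable
  have [measurable]: "m \<in> borel_measurable M" unfolding m_def[abs_def] by (intro mk) measurable
  have \<tau>_meas[measurable]: "\<tau> \<in> borel_measurable M" unfolding \<tau>_def[abs_def] by measurable

  have w_B: "w x = (\<integral>t. indicator (B x) t \<partial>lebesgue)" for x
    unfolding w_def by (intro Bochner_Integration.integral_cong) (auto simp: B_def V_def split: split_indicator)
  have m_B: "m x = (\<integral>t. t * indicator (B x) t \<partial>lebesgue)" for x
    unfolding m_def by (intro Bochner_Integration.integral_cong) (auto simp: B_def V_def split: split_indicator)
  have close: "\<bar>q - p\<bar> < 1" if "x \<in> space M" "p \<in> V x" "q \<in> V x" "\<bar>q - p\<bar> \<le> 2 * H + 2" for x p q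
    using sep[of "T p x" "q - p"] that flow_add[of x "q - p" p] by (auto simp: V_def)
  have B_sets: "B x \<in> sets lebesgue" if "x \<in> G" for x
    using that by (auto simp: B_def G_def)
  have B_finite: "emeasure lebesgue (B x) < \<infinity>" if "x \<in> G" for x
  proof -
    have "emeasure lebesgue (B x) \<le> emeasure lebesgue {- H - 1..1}"
      by (intro emeasure_mono) (auto simp: B_def)
    also have "\<dots> < \<infinity>" by (simp add: emeasure_lborel_Icc_eq)
    finally show ?thesis .
  qed
  have int1: "integrable lebesgue (indicator (B x) :: real \<Rightarrow> real)" if "x \<in> G" for x
    using B_sets[OF that] B_finite[OF that] by simp
  have int2: "integrable lebesgue (\<lambda>t. t * indicator (B x) t)" if "x \<in> G" for x
  proof (rule Bochner_Integration.integrable_bound)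
    show "integrable lebesgue (\<lambda>t. (H + 2) * indicator (B x) t :: real)" using int1[OF that] by simp
    have "(\<lambda>t::real. t) \<in> borel_measurable lebesgue" by (intro measurable_completion) simp
    then show "(\<lambda>t. t * indicator (B x) t) \<in> borel_measurable lebesgue"
      using B_sets[OF that] by (intro borel_measurable_times borel_measurable_indicator)
    show "AE t in lebesgue. norm (t * indicator (B x) t) \<le> norm ((H + 2) * indicator (B x) t :: real)"
      using H by (auto simp: B_def split: split_indicator)
  qed
  have bary: "\<bar>q - m x / w x\<bar> \<le> 1" if x: "x \<in> G" "0 < w x" and q: "\<And>p. p \<in> B x \<Longrightarrow> \<bar>q - p\<bar> \<le> 1" for x q
  proof -
    have q': "q - 1 \<le> p" "p \<le> q + 1" if "p \<in> B x" for p
      using q[OF that] by linarith+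
    have "(\<integral>t. (q - 1) * indicator (B x) t \<partial>lebesgue) \<le> m x"
      unfolding m_B using q' by (intro integral_mono int2 integrable_mult_right int1 x) (auto split: split_indicator)
    then have 1: "(q - 1) * w x \<le> m x" by (simp add: w_B)
    have "m x \<le> (\<integral>t. (q + 1) * indicator (B x) t \<partial>lebesgue)"
      unfolding m_B using q' by (intro integral_mono int2 integrable_mult_right int1 x) (auto split: split_indicator)
    then have 2: "m x \<le> (q + 1) * w x" by (simp add: w_B)
    from 1 2 x(2) have "q - 1 \<le> m x / w x" "m x / w x \<le> q + 1" by (simp_all add: pos_le_divide_eq pos_divide_le_eq)
    then show ?thesis by linarith
  qed
  have near: "\<bar>q - m x / w x\<bar> \<le> 1"
    if x: "x \<in> G" "0 < w x" and q: "q \<in> V x" "q \<in> {- 2 * H - 1..H + 1}" for x q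
  proof (rule bary[OF x])
    fix p assume p: "p \<in> B x"
    then have "\<bar>q - p\<bar> \<le> 2 * H + 2" using q(2) by (simp add: B_def abs_le_iff)
    then show "\<bar>q - p\<bar> \<le> 1" using close[of x p q] p q(1) x(1) by (simp add: B_def G_def)
  qed
  have shift: "\<tau> (T u x) = \<tau> x + u"
    if x: "x \<in> space M" and t: "0 \<le> \<tau> x" "\<tau> x < H" "0 \<le> \<tau> x + u" "\<tau> x + u < H" for x u
  proof -
    have xG: "x \<in> G" and w: "0 < w x" and \<tau>: "\<tau> x = - (m x / w x)"
      using t(1) by (auto simp: \<tau>_def split: if_splits)
    have V: "t \<in> V (T u x) \<longleftrightarrow> u + t \<in> V x" for t
      using flow_add[OF x, of t u] by (simp add: V_def add.commute)
    \<comment> \<open>Moving the window neither gains nor loses visits: by \<open>near\<close>,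
      every visit in either window is within 1 of the barycentre for \<open>x\<close>, and this
      barycentre and its translate by \<open>- u\<close> both lie in
      \<open>{- H<..0}\<close>.\<close>
    have B_T: "t \<in> B (T u x) \<longleftrightarrow> u + t \<in> B x" for t
    proof
      assume t': "t \<in> B (T u x)"
      then have "\<bar>(u + t) - m x / w x\<bar> \<le> 1" using t H by (intro near xG w) (auto simp: B_def V)
      then show "u + t \<in> B x" using t' t \<tau> by (auto simp: B_def V)
    next
      assume t': "u + t \<in> B x"
      then have "\<bar>(u + t) - m x / w x\<bar> \<le> 1" using H by (intro near xG w) (auto simp: B_def)
      then show "t \<in> B (T u x)" using t' t \<tau> by (auto simp: B_def V)
    qed
    have ind: "indicator (B (T u x)) t = (indicator (B x) (u + t) :: real)" for t
      by (simp add: indicator_def B_T)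
    have "(\<lambda>t. u + 1 * t) \<in> lebesgue \<rightarrow>\<^sub>M lebesgue"
      using lebesgue_affine_measurable[where c = "\<lambda>x::real. 1" and t = u] by simp
    from measurable_sets[OF this, of "V x"] have "T u x \<in> G"
      using xG T_space by (auto simp: G_def V vimage_def set_eq_iff[of "V _"] elim!: back_subst[of "\<lambda>A. A \<in> sets lebesgue"])
    moreover have wT: "w (T u x) = w x"
      using lebesgue_integral_real_affine[of 1 "indicator (B x) :: real \<Rightarrow> real" u]
      by (simp add: w_B ind)
    moreover have "m (T u x) = m x - u * w x"
    proof -
      have "m x = (\<integral>t. (u + t) * indicator (B x) (u + t) \<partial>lebesgue)"
        using lebesgue_integral_real_affine[of 1 "\<lambda>t. t * indicator (B x) t" u] by (simp add: m_B)
      also have "\<dots> = (\<integral>t. u * indicator (B (T u x)) t + t * indicator (B (T u x)) t \<partial>lebesgue)"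
        by (simp add: ind distrib_right)
      also have "\<dots> = u * w (T u x) + m (T u x)"
        using int1[OF \<open>T u x \<in> G\<close>] int2[OF \<open>T u x \<in> G\<close>] by (simp add: w_B m_B)
      finally show ?thesis using wT by simp
    qed
    ultimately show ?thesis using w by (simp add: \<tau>_def xG diff_divide_distrib)
  qed
  have "emeasure M {x \<in> space M. 0 \<le> \<tau> x \<and> \<tau> x < H} \<noteq> 0"
  proof
    assume "emeasure M {x \<in> space M. 0 \<le> \<tau> x \<and> \<tau> x < H} = 0"
    then have "{x \<in> space M. 0 \<le> \<tau> x \<and> \<tau> x < H} \<in> null_sets M" by (intro null_setsI) measurable
    then have out: "AE x in M. \<not> (0 \<le> \<tau> x \<and> \<tau> x < H)" by (simp add: AE_iff_null_sets)
    have "AE x in M. (\<integral>\<^sup>+t. indicator {- (H - 2)..- 1} t * indicator A (T t x) \<partial>lebesgue) = 0"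
      using out AE_G
    proof eventually_elim
      case (elim x)
      \<comment> \<open>A non-null set \<open>D\<close> of visits would put the barycentre in
        \<open>{- (H - 1)..0}\<close> and hence \<open>x\<close> in the tower. So a null tower
        leaves almost no visits in an interval of positive length, as \<open>H > 3\<close>, which
        contradicts \<open>occupation_time\<close>.\<close>
      define D where "D = V x \<inter> {- (H - 2)..- 1}"
      have DB: "D \<subseteq> B x" by (auto simp: D_def B_def)
      have x: "x \<in> space M" and [measurable]: "D \<in> sets lebesgue" using elim(2) by (auto simp: D_def G_def)
      have "D \<in> null_sets lebesgue"
      proof (rule ccontr)
        assume D: "D \<notin> null_sets lebesgue"
        then have "emeasure lebesgue (B x) \<noteq> 0"
          using emeasure_mono[OF DB B_sets[OF elim(2)]] by (auto simp: null_sets_def)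
        then have w: "0 < w x"
          using B_finite[OF elim(2)] B_sets[OF elim(2)]
          by (simp add: w_B measure_def enn2real_positive_iff zero_less_iff_neq_zero)
        obtain p where p: "p \<in> D" using D by (cases "D = {}") auto
        then have "\<bar>p - m x / w x\<bar> \<le> 1" using H by (intro near w elim) (auto simp: D_def)
        then show False using elim p w by (auto simp: \<tau>_def D_def)
      qed
      then have "(\<integral>\<^sup>+t. indicator D t \<partial>lebesgue) = 0" by (subst nn_integral_indicator) auto
      also have "(\<integral>\<^sup>+t. indicator D t \<partial>lebesgue) = (\<integral>\<^sup>+t. indicator {- (H - 2)..- 1} t * indicator A (T t x) \<partial>lebesgue)"
        by (intro nn_integral_cong) (auto simp: D_def V_def split: split_indicator)
      finally show ?case .
    qed
    then have "(\<integral>\<^sup>+x. (\<integral>\<^sup>+t. indicator {- (H - 2)..- 1} t * indicator A (T t x) \<partial>lebesgue) \<partial>M) = 0"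
      by (subst nn_integral_cong_AE[where v = "\<lambda>x. 0"]) auto
    then show False using occupation_time[OF A, of "{- (H - 2)..- 1}"] A_pos H by simp
  qed
  moreover have "flow_tower M T \<tau> H" by unfold_locales (use \<tau>_meas shift in auto)
  ultimately show thesis using that by (simp add: zero_less_iff_neq_zero)
qed

end

lemma complete_measure_restrict_space:
  assumes "complete_measure M" "Z \<in> sets M"
  shows "complete_measure (restrict_space M Z)"
proof
  fix A B assume "B \<subseteq> A" "A \<in> null_sets (restrict_space M Z)"
  then show "B \<in> sets (restrict_space M Z)"
    using assms complete_measure.complete[OF assms(1), of B A]
    by (auto simp: null_sets_restrict_space sets_restrict_space)
qed

section \<open>Levels and heights in a tower\<close>

context flow_tower
begin

definition level :: "real \<Rightarrow> real \<Rightarrow> 'a set" where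
  "level a b = {x \<in> space M. a \<le> \<tau> x \<and> \<tau> x < b}"

lemma sets_level[measurable]: "level a b \<in> sets M"
  unfolding level_def by measurable

text \<open>By \<open>height_flow\<close> for \<open>u\<close> and for \<open>- u\<close>, the
  preimage of the upper or lower slice under \<open>T u\<close> is exactly the other slice.\<close>

lemma emeasure_level_shift:
  assumes "0 \<le> a" "b \<le> H" "0 \<le> a + u" "b + u \<le> H"
  shows "emeasure M (level (a + u) (b + u)) = emeasure M (level a b)"
proof -
  have "T u -` level (a + u) (b + u) \<inter> space M = level a b"
  proof (intro equalityI subsetI)
    fix x assume "x \<in> level a b"
    then show "x \<in> T u -` level (a + u) (b + u) \<inter> space M"
      using height_flow[of x u] assms T_space by (auto simp: level_def)
  next
    fix x assume x: "x \<in> T u -` level (a + u) (b + u) \<inter> space M"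
    then have "T (- u) (T u x) = x" using flow_add[of x "- u" u] flow_zero by simp
    then show "x \<in> level a b"
      using x height_flow[of "T u x" "- u"] assms by (auto simp: level_def)
  qed
  then show ?thesis using measure_preserving[OF sets_level, of u "a + u" "b + u"] by simp
qed

text \<open>The slices of thickness \<open>S\<close> are disjoint and of equal measure. This
  measures the loss at the top as a fraction of the tower.\<close>

lemma emeasure_level_mult:
  assumes "0 < S" "real n * S \<le> H"
  shows "emeasure M (level 0 (n * S)) = of_nat n * emeasure M (level 0 S)"
  using assms(2)
proof (induction n)
  case 0
  have "level 0 0 = {}" by (auto simp: level_def)
  then show ?case by simp
next
  case (Suc n)
  have nS: "0 \<le> real n * S" "real n * S + S \<le> H" using Suc.prems assms(1) by (auto simp: algebra_simps)
  then have "S \<le> H" by linarith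
  have "level 0 (real (Suc n) * S) = level 0 (real n * S) \<union> level (0 + real n * S) (S + real n * S)"
    using nS assms(1) by (auto simp: level_def distrib_right dest: order_trans[OF nS(1)])
  moreover have "level 0 (real n * S) \<inter> level (0 + real n * S) (S + real n * S) = {}"
    by (auto simp: level_def)
  ultimately have "emeasure M (level 0 (real (Suc n) * S)) =
      emeasure M (level 0 (real n * S)) + emeasure M (level (0 + real n * S) (S + real n * S))"
    by (simp add: plus_emeasure)
  also have "emeasure M (level (0 + real n * S) (S + real n * S)) = emeasure M (level 0 S)"
    using nS \<open>S \<le> H\<close> by (intro emeasure_level_shift) (auto simp: add.commute)
  finally show ?case using Suc.IH nS assms(1) by (simp add: algebra_simps)
qed

text \<open>Only the lower half of the tower is considered, so that it can be moved upwards by a whole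
  interval of times.\<close>

lemma height_null_set:
  assumes "0 < H" "P \<in> null_sets lebesgue"
  shows "{x \<in> level 0 (H / 2). \<tau> x \<in> P} \<in> null_sets M"
proof -
  obtain P' where P': "P' \<in> null_sets lborel" "P \<subseteq> P'"
    using assms(2) by (auto simp: null_sets_completion_iff2)
  then have [measurable]: "P' \<in> sets borel" by auto
  interpret L: pair_sigma_finite M lborel ..
  \<comment> \<open>For each \<open>z\<close> almost every shift \<open>u\<close> moves the height
    off \<open>P'\<close>. After exchanging the quantifiers, some \<open>u\<close> below
    \<open>H / 2\<close> works for almost all \<open>z\<close>, and moving the lower half up by
    \<open>u\<close> stays in the tower.\<close>
  have "AE u in lborel. \<tau> z + - 1 * u \<notin> P'" for z
    by (rule AE_borel_affine[OF _ _ AE_not_in[OF P'(1)]]) auto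
  then have "AE z in M. AE u in lborel. \<tau> z - u \<notin> P'" by simp
  then have *: "AE u in lborel. AE z in M. \<tau> z - u \<notin> P'"
    by (subst (asm) L.AE_commute) measurable
  obtain u where u: "0 < u" "u < H / 2" "AE z in M. \<tau> z - u \<notin> P'"
  proof (rule ccontr)
    assume "\<not> thesis"
    with that have "\<And>u. 0 < u \<Longrightarrow> u < H / 2 \<Longrightarrow> \<not> (AE z in M. \<tau> z - u \<notin> P')" by blast
    with * have "AE u in lborel. u \<notin> {0<..<H / 2}"
      by (auto elim!: eventually_mono)
    then have "{0<..<H / 2} \<in> null_sets lborel"
      by (subst Measure_Space.AE_iff_null_sets) auto
    then show False using assms(1) by (auto simp: null_sets_def)
  qed
  define Q where "Q = {z \<in> space M. \<tau> z - u \<in> P'}"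
  have [measurable]: "Q \<in> sets M" unfolding Q_def by measurable
  have Q: "Q \<in> null_sets M" using u(3) by (simp add: AE_iff_null_sets Q_def)
  have "T u -` Q \<inter> space M \<in> null_sets M"
    using measure_preserving[of Q u] Q measurable_sets[OF measurable_transformation, of Q u]
    by (auto simp: null_sets_def)
  moreover have "{x \<in> level 0 (H / 2). \<tau> x \<in> P} \<subseteq> T u -` Q \<inter> space M"
    using u height_flow[of _ u] P'(2) T_space by (auto simp: level_def Q_def)
  ultimately show ?thesis by (rule complete2[rotated])
qed

abbreviation tower :: "'a measure" where
  "tower \<equiv> restrict_space M (level 0 (H / 2))"

text \<open>Since Lebesgue null sets of heights have null preimages, Borel measurability of
  \<open>\<tau>\<close> improves to Lebesgue measurability.\<close>

lemma measurable_height_lebesgue: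
  assumes "0 < H"
  shows "\<tau> \<in> measurable tower lebesgue"
proof (rule complete_measure.measurable_completion2)
  show "complete_measure tower"
    by (intro complete_measure_restrict_space sets_level) unfold_locales
  show \<tau>: "\<tau> \<in> measurable tower lborel"
    by (intro measurable_restrict_space1) simp
  show "null_sets lborel \<subseteq> null_sets (distr tower lborel \<tau>)"
  proof
    fix P :: "real set" assume P: "P \<in> null_sets lborel"
    then have "{x \<in> level 0 (H / 2). \<tau> x \<in> P} \<in> null_sets M"
      by (intro height_null_set assms null_sets_completionI)
    moreover have "\<tau> -` P \<inter> level 0 (H / 2) = {x \<in> level 0 (H / 2). \<tau> x \<in> P}" by auto
    ultimately show "P \<in> null_sets (distr tower lborel \<tau>)"
      using P \<tau> by (auto simp: null_sets_def emeasure_distr emeasure_restrict_space)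
  qed
qed

lemma complete_pair_tower:
  assumes "prob_space N" "complete_measure N"
  shows "complete_pair tower N"
  by (intro complete_pair.intro pair_sigma_finite.intro assms prob_space_imp_sigma_finite
      finite_measure.sigma_finite_measure finite_measure_restrict_space complete_measure_restrict_space sets_level)
    unfold_locales

text \<open>The map factors through \<open>(y, \<tau> x)\<close> and the flow \<open>U\<close>,
  which is measurable only for the completion of \<open>N \<Otimes>\<^sub>M lebesgue\<close>. The
  first factor must therefore pull null sets back to null sets.\<close>

lemma measurable_skew:
  fixes N :: "'b measure"
  assumes H: "0 < H" and N: "dynamical_system N U" and f: "f \<in> measurable N L"
  shows "(\<lambda>z. f (U (\<tau> (fst z)) (snd z))) \<in> measurable (completion (tower \<Otimes>\<^sub>M N)) L"
proof -
  interpret N: dynamical_system N U by (rule N)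
  interpret P: complete_pair tower N by (rule complete_pair_tower) unfold_locales
  note [measurable] = measurable_height_lebesgue[OF H]
  define \<psi> where "\<psi> z = (snd z, \<tau> (fst z))" for z :: "'a \<times> 'b"
  have \<psi>[measurable]: "\<psi> \<in> measurable (tower \<Otimes>\<^sub>M N) (N \<Otimes>\<^sub>M lebesgue)"
    unfolding \<psi>_def by measurable
  have "\<psi> \<in> measurable (completion (tower \<Otimes>\<^sub>M N)) (completion (N \<Otimes>\<^sub>M lebesgue))"
  proof (rule measurable_completion_completion[OF \<psi>])
    fix Q assume Q: "Q \<in> null_sets (N \<Otimes>\<^sub>M (lebesgue :: real measure))"
    then have [measurable]: "Q \<in> sets (N \<Otimes>\<^sub>M (lebesgue :: real measure))" by auto
    have "AE t in lebesgue. AE y in N. (y, t) \<notin> Q"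
      by (rule N.orbit.AE_AE(2)[OF AE_not_in[OF Q]])
    \<comment> \<open>The times whose section of \<open>Q\<close> is not null form a null set, so
      almost no point of the tower has such a height.\<close>
    then have "{t. \<not> (AE y in N. (y, t) \<notin> Q)} \<in> null_sets lebesgue"
      by (simp add: completion.AE_iff_null_sets)
    from height_null_set[OF H this]
    have "AE x in M. x \<in> level 0 (H / 2) \<longrightarrow> (AE y in N. (y, \<tau> x) \<notin> Q)"
      by (auto dest!: AE_not_in)
    then have "AE x in tower. AE y in N. (x, y) \<notin> \<psi> -` Q"
      by (subst AE_restrict_space_iff) (auto simp: \<psi>_def)
    then have "AE z in tower \<Otimes>\<^sub>M N. z \<notin> \<psi> -` Q"
      by (intro P.AE_pair_measure) (auto simp: \<psi>_def, measurable)
    then show "\<psi> -` Q \<inter> space (tower \<Otimes>\<^sub>M N) \<in> null_sets (tower \<Otimes>\<^sub>M N)"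
      using measurable_sets[OF \<psi>, of Q] by (subst Measure_Space.AE_iff_null_sets) (auto elim: eventually_mono)
  qed
  from measurable_compose[OF this N.measurable_along_orbit[OF f]]
  show ?thesis by (simp add: \<psi>_def)
qed

text \<open>Integrating over \<open>y\<close> first, invariance under \<open>U (\<tau> x)\<close>
  removes the height.\<close>

lemma nn_integral_skew:
  fixes N :: "'b measure" and f :: "'b \<Rightarrow> ennreal"
  assumes H: "0 < H" and N: "dynamical_system N U" and f[measurable]: "f \<in> borel_measurable N"
    and Z[measurable]: "Z \<in> sets M" "Z \<subseteq> level 0 (H / 2)"
  shows "(\<integral>\<^sup>+y. (\<integral>\<^sup>+x. indicator Z x * f (U (\<tau> x) y) \<partial>tower) \<partial>N) = emeasure M Z * (\<integral>\<^sup>+y. f y \<partial>N)"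
proof -
  interpret N: dynamical_system N U by (rule N)
  interpret P: complete_pair tower N by (rule complete_pair_tower) unfold_locales
  have [measurable]: "U t \<in> measurable N N" for t by (rule N.measurable_transformation)
  have "(\<lambda>z. indicator Z (fst z) * f (U (\<tau> (fst z)) (snd z))) \<in> borel_measurable (completion (tower \<Otimes>\<^sub>M N))"
  proof (intro borel_measurable_times_ennreal measurable_skew[OF H N f] measurable_completion)
    have "indicator Z \<in> borel_measurable tower"
      by (intro measurable_restrict_space1) measurable
    then show "(\<lambda>z. indicator Z (fst z) :: ennreal) \<in> borel_measurable (tower \<Otimes>\<^sub>M N)"
      by (rule measurable_compose[OF measurable_fst])
  qed
  from P.Fubini_completion[OF this]
  have "(\<integral>\<^sup>+y. (\<integral>\<^sup>+x. indicator Z x * f (U (\<tau> x) y) \<partial>tower) \<partial>N)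
      = (\<integral>\<^sup>+x. (\<integral>\<^sup>+y. indicator Z x * f (U (\<tau> x) y) \<partial>N) \<partial>tower)" by simp
  also have "\<dots> = (\<integral>\<^sup>+x. indicator Z x * (\<integral>\<^sup>+y. f y \<partial>N) \<partial>tower)"
    by (intro nn_integral_cong) (simp add: nn_integral_cmult N.nn_integral_T)
  also have "\<dots> = (\<integral>\<^sup>+x. indicator Z x * (\<integral>\<^sup>+y. f y \<partial>N) \<partial>M)"
    using Z by (subst nn_integral_restrict_space) (auto intro!: nn_integral_cong split: split_indicator)
  also have "\<dots> = emeasure M Z * (\<integral>\<^sup>+y. f y \<partial>N)"
    by (subst nn_integral_multc) auto
  finally show ?thesis .
qed

end

section \<open>Transference\<close>

text \<open>Truncation at \<open>K\<close> leaves finitely many times \<open>s i\<close>, which a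
  high tower can accommodate.\<close>

definition average_exceeds :: "'b measure \<Rightarrow> (real \<Rightarrow> 'b \<Rightarrow> 'b) \<Rightarrow> (nat \<Rightarrow> real) \<Rightarrow> ('b \<Rightarrow> real) \<Rightarrow> nat \<Rightarrow> real \<Rightarrow> 'b set" where
  "average_exceeds N U s f K \<gamma> = {y \<in> space N. \<exists>n\<in>{1..K}. \<gamma> \<le> (1 / real n) * (\<Sum>i=1..n. f (U (s i) y))}"

lemma (in dynamical_system) sets_average_exceeds:
  assumes [measurable]: "f \<in> borel_measurable M"
  shows "average_exceeds M T s f K \<gamma> \<in> sets M"
proof -
  have [measurable]: "T t \<in> measurable M M" for t by (rule measurable_transformation)
  show ?thesis unfolding average_exceeds_def by measurable
qed

text \<open>Tested on the constant function 1 with \<open>\<gamma> = 1\<close>. The resulting sign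
  of \<open>C\<close> allows products with \<open>C / \<gamma>\<close> to be computed in the
  extended nonnegative reals.\<close>

lemma (in dynamical_system) maximal_inequality_imp_ge_1:
  assumes "maximal_inequality M T s C"
  shows "1 \<le> C"
proof -
  have "maximal_average T s (\<lambda>x. 1) x \<ge> ereal 1" for x
    unfolding maximal_average_def by (rule SUP_upper2[of 1]) auto
  then have "{x \<in> space M. maximal_average T s (\<lambda>x. 1) x \<ge> ereal 1} = space M" by auto
  moreover have "measure M {x \<in> space M. maximal_average T s (\<lambda>x. 1) x \<ge> ereal 1} \<le> C / 1 * (\<integral>x. \<bar>1\<bar> \<partial>M)"
    using assms[unfolded maximal_inequality_def, rule_format, of "\<lambda>x. 1" 1] by simp
  ultimately show ?thesis by (simp add: prob_space)
qed

context flow_tower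
begin

text \<open>For almost every \<open>y\<close>, the inequality on \<open>M\<close> is applied to
  \<open>F y\<close>. Integration over \<open>y\<close> turns both sides into products by
  \<open>nn_integral_skew\<close>.\<close>

lemma transferred_inequality_integrated:
  fixes N :: "'b measure" and f :: "'b \<Rightarrow> real"
  assumes max: "maximal_inequality M T s C" and s: "\<And>n. n \<ge> 1 \<Longrightarrow> s n > 0"
    and N: "dynamical_system N U" and f: "integrable N f" and \<gamma>: "\<gamma> > 0" and H: "0 < H"
    and S: "\<And>i. i \<in> {1..K} \<Longrightarrow> s i \<le> S"
  shows "emeasure M (level 0 (H / 2 - S)) * emeasure N (average_exceeds N U s f K \<gamma>)
    \<le> ennreal (C / \<gamma>) * (emeasure M (level 0 (H / 2)) * (\<integral>\<^sup>+y. \<bar>f y\<bar> \<partial>N))"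
\<comment> \<open>For \<open>K = 0\<close> the exceeding set is empty; otherwise the positive number
  \<open>s 1\<close> forces \<open>S > 0\<close>.\<close>
proof (cases "K = 0")
  case True
  then show ?thesis by (simp add: average_exceeds_def)
next
  case False
  then have S_pos: "0 < S" using S[of 1] s[of 1] by auto
  interpret N: dynamical_system N U by (rule N)
  interpret P: complete_pair tower N by (rule complete_pair_tower) unfold_locales
  have f_meas[measurable]: "f \<in> borel_measurable N" using f by simp
  define Q where "Q = average_exceeds N U s f K \<gamma>"
  have Q[measurable]: "Q \<in> sets N" unfolding Q_def by (rule N.sets_average_exceeds) simp
  define F where "F y x = (if x \<in> level 0 (H / 2) then f (U (\<tau> x) y) else 0)" for y x
  have low: "level 0 (H / 2 - S) \<subseteq> level 0 (H / 2)" using S_pos by (auto simp: level_def)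
  have nn_F: "(\<integral>\<^sup>+x. ennreal \<bar>F y x\<bar> \<partial>M) = (\<integral>\<^sup>+x. indicator (level 0 (H / 2)) x * ennreal \<bar>f (U (\<tau> x) y)\<bar> \<partial>tower)" for y
    by (subst nn_integral_restrict_space) (auto simp: F_def intro!: nn_integral_cong split: split_indicator)
  have total: "(\<integral>\<^sup>+y. (\<integral>\<^sup>+x. ennreal \<bar>F y x\<bar> \<partial>M) \<partial>N) = emeasure M (level 0 (H / 2)) * (\<integral>\<^sup>+y. \<bar>f y\<bar> \<partial>N)"
    unfolding nn_F by (intro nn_integral_skew[OF H N]) auto
  have F_meas: "AE y in N. F y \<in> borel_measurable M"
    using P.AE_measurable_section_real'[OF measurable_skew[OF H N f_meas]]
  proof eventually_elim
    case (elim y)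
    then have "(\<lambda>x. indicator (level 0 (H / 2)) x *\<^sub>R f (U (\<tau> x) y)) \<in> borel_measurable M"
      by (subst (asm) borel_measurable_restrict_space_iff) auto
    also have "(\<lambda>x. indicator (level 0 (H / 2)) x *\<^sub>R f (U (\<tau> x) y)) = F y"
      by (auto simp: F_def fun_eq_iff)
    finally show ?case .
  qed
  have nn_meas: "(\<lambda>y. \<integral>\<^sup>+x. ennreal \<bar>F y x\<bar> \<partial>M) \<in> borel_measurable N"
  proof -
    have "(\<lambda>z. indicator (level 0 (H / 2)) (fst z) * ennreal \<bar>f (U (\<tau> (fst z)) (snd z))\<bar>)
        \<in> borel_measurable (completion (tower \<Otimes>\<^sub>M N))"
    proof (intro borel_measurable_times_ennreal measurable_skew[OF H N, of "\<lambda>y. ennreal \<bar>f y\<bar>"] measurable_completion)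
      have "indicator (level 0 (H / 2)) \<in> borel_measurable tower"
        by (intro measurable_restrict_space1) measurable
      then show "(\<lambda>z. indicator (level 0 (H / 2)) (fst z) :: ennreal) \<in> borel_measurable (tower \<Otimes>\<^sub>M N)"
        by (rule measurable_compose[OF measurable_fst])
    qed measurable
    from P.measurable_nn_integral_completion'[OF this] show ?thesis by (simp add: nn_F)
  qed
  have "(\<integral>\<^sup>+y. \<bar>f y\<bar> \<partial>N) < \<infinity>" using f by (simp add: integrable_iff_bounded)
  then have "(\<integral>\<^sup>+y. (\<integral>\<^sup>+x. ennreal \<bar>F y x\<bar> \<partial>M) \<partial>N) \<noteq> \<infinity>"
    unfolding total by (auto simp: ennreal_mult_eq_top_iff)
  \<comment> \<open>A finite double integral makes \<open>F y\<close> integrable for almost every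
    \<open>y\<close>, as the maximal inequality demands.\<close>
  then have F_fin: "AE y in N. (\<integral>\<^sup>+x. ennreal \<bar>F y x\<bar> \<partial>M) \<noteq> \<infinity>"
    by (rule nn_integral_PInf_AE[OF nn_meas])
  have "AE y in N. (\<integral>\<^sup>+x. indicator (level 0 (H / 2 - S)) x * indicator Q (U (\<tau> x) y) \<partial>tower)
      \<le> ennreal (C / \<gamma>) * (\<integral>\<^sup>+x. ennreal \<bar>F y x\<bar> \<partial>M)"
    using F_meas F_fin AE_space
  proof eventually_elim
    case (elim y)
    then have int: "integrable M (F y)"
      by (auto simp: integrable_iff_bounded less_top[symmetric])
    define W where "W = {x \<in> space M. maximal_average T s (F y) x \<ge> ereal \<gamma>}"
    have W[measurable]: "W \<in> sets M" unfolding W_def using int by (rule sets_maximal_average_ge)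
    \<comment> \<open>From below \<open>H / 2 - S\<close>, each time \<open>s i \<le> S\<close>
      leads to a point still in the lower half, where \<open>F y\<close> is read off from
      \<open>f\<close> at height \<open>\<tau> x + s i\<close>.\<close>
    have in_W: "x \<in> W" if x: "x \<in> level 0 (H / 2 - S)" "U (\<tau> x) y \<in> Q" for x
    proof -
      from x(2) obtain n where n: "n \<in> {1..K}" and ge: "\<gamma> \<le> (1 / real n) * (\<Sum>i=1..n. f (U (s i) (U (\<tau> x) y)))"
        by (auto simp: Q_def average_exceeds_def)
      have "F y (T (s i) x) = f (U (s i) (U (\<tau> x) y))" if i: "i \<in> {1..n}" for i
      proof -
        have si: "0 < s i" "s i \<le> S" using i n s S by auto
        then have "\<tau> (T (s i) x) = \<tau> x + s i"
          using x(1) H by (intro height_flow) (auto simp: level_def)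
        moreover have "T (s i) x \<in> level 0 (H / 2)"
          using calculation x(1) si T_space by (auto simp: level_def)
        ultimately show ?thesis
          using N.flow_add[OF elim(3), of "s i" "\<tau> x"] by (simp add: F_def add.commute)
      qed
      then have "ereal \<gamma> \<le> ereal ((1 / real n) * (\<Sum>i=1..n. F y (T (s i) x)))"
        using ge by simp
      also have "\<dots> \<le> maximal_average T s (F y) x"
        unfolding maximal_average_def using n by (intro SUP_upper) auto
      finally show ?thesis using x(1) by (simp add: W_def level_def)
    qed
    have "(\<integral>\<^sup>+x. indicator (level 0 (H / 2 - S)) x * indicator Q (U (\<tau> x) y) \<partial>tower)
        \<le> (\<integral>\<^sup>+x. indicator W x \<partial>M)"
    proof (subst nn_integral_restrict_space)
      show "level 0 (H / 2) \<inter> space M \<in> sets M" by measurable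
    qed (intro nn_integral_mono, use in_W in \<open>auto split: split_indicator\<close>)
    also have "\<dots> = ennreal (measure M W)" by (simp add: emeasure_eq_measure)
    also have "\<dots> \<le> ennreal (C / \<gamma> * (\<integral>x. \<bar>F y x\<bar> \<partial>M))"
      using max int \<gamma> unfolding maximal_inequality_def W_def by (intro ennreal_leI) blast
    also have "\<dots> = ennreal (C / \<gamma>) * ennreal (\<integral>x. \<bar>F y x\<bar> \<partial>M)"
      using maximal_inequality_imp_ge_1[OF max] \<gamma> by (intro ennreal_mult) auto
    also have "ennreal (\<integral>x. \<bar>F y x\<bar> \<partial>M) = (\<integral>\<^sup>+x. ennreal \<bar>F y x\<bar> \<partial>M)"
      using int by (intro nn_integral_eq_integral[symmetric]) auto
    finally show ?case .
  qed
  then have "(\<integral>\<^sup>+y. (\<integral>\<^sup>+x. indicator (level 0 (H / 2 - S)) x * indicator Q (U (\<tau> x) y) \<partial>tower) \<partial>N)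
      \<le> (\<integral>\<^sup>+y. ennreal (C / \<gamma>) * (\<integral>\<^sup>+x. ennreal \<bar>F y x\<bar> \<partial>M) \<partial>N)"
    by (rule nn_integral_mono_AE)
  also have "\<dots> = ennreal (C / \<gamma>) * (emeasure M (level 0 (H / 2)) * (\<integral>\<^sup>+y. \<bar>f y\<bar> \<partial>N))"
    by (subst nn_integral_cmult[OF nn_meas]) (simp add: total)
  also have "(\<integral>\<^sup>+y. (\<integral>\<^sup>+x. indicator (level 0 (H / 2 - S)) x * indicator Q (U (\<tau> x) y) \<partial>tower) \<partial>N)
      = emeasure M (level 0 (H / 2 - S)) * emeasure N Q"
    by (subst nn_integral_skew[OF H N _ _ low]) auto
  finally show ?thesis by (simp add: Q_def)
qed

end

text \<open>With \<open>Suc n\<close> slices of thickness \<open>S\<close> in the lower half of the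
  tower, only the top one is lost. The factor \<open>Suc n / n\<close> this costs tends to
  1.\<close>

lemma (in dynamical_system) transferred_finite_inequality:
  fixes N :: "'b measure" and f :: "'b \<Rightarrow> real"
  assumes ap: "aperiodic M T" and max: "maximal_inequality M T s C" and s: "\<And>n. n \<ge> 1 \<Longrightarrow> s n > 0"
    and N: "dynamical_system N U" and f: "integrable N f" and \<gamma>: "\<gamma> > 0"
  shows "measure N (average_exceeds N U s f K \<gamma>) \<le> C / \<gamma> * (\<integral>y. \<bar>f y\<bar> \<partial>N)"
proof -
  interpret N: dynamical_system N U by (rule N)
  \<comment> \<open>The sum dominates every \<open>s i\<close> because the terms are positive; the
    summand 4 ensures \<open>H > 3\<close> below.\<close>
  define S where "S = 4 + (\<Sum>i=1..K. s i)"
  have nonneg: "0 \<le> s i" if "i \<in> {1..K}" for i using s[of i] that by simp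
  have S: "s i \<le> S" if "i \<in> {1..K}" for i
    using member_le_sum[OF that, of s] nonneg by (simp add: S_def)
  have "0 \<le> (\<Sum>i=1..K. s i)" using nonneg by (rule sum_nonneg)
  then have S4: "4 \<le> S" by (simp add: S_def)
  define q where "q = measure N (average_exceeds N U s f K \<gamma>)"
  define r where "r = C / \<gamma> * (\<integral>y. \<bar>f y\<bar> \<partial>N)"
  have r0: "0 \<le> r" using maximal_inequality_imp_ge_1[OF max] \<gamma> by (simp add: r_def)
  have bound: "real n * q \<le> real (Suc n) * r" for n
  proof -
    define H where "H = 2 * real (Suc n) * S"
    have "S \<le> H" using S4 by (simp add: H_def algebra_simps)
    then have "H > 3" using S4 by simp
    obtain \<tau> where "flow_tower M T \<tau> H" and pos: "emeasure M {x \<in> space M. 0 \<le> \<tau> x \<and> \<tau> x < H} > 0"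
      using ex_flow_tower[OF ap \<open>H > 3\<close>] .
    then interpret F: flow_tower M T \<tau> H by simp
    define c where "c = measure M (F.level 0 S)"
    have level: "emeasure M (F.level 0 (real k * S)) = ennreal (real k * c)" if "k \<le> 2 * Suc n" for k
    proof -
      have "real k \<le> real (2 * Suc n)" using that by (rule of_nat_mono)
      then have "real k * S \<le> H"
        unfolding H_def of_nat_mult of_nat_numeral using S4 by (intro mult_right_mono) auto
      then have "emeasure M (F.level 0 (real k * S)) = of_nat k * emeasure M (F.level 0 S)"
        using S4 by (intro F.emeasure_level_mult) auto
      then show ?thesis
        by (simp add: c_def emeasure_eq_measure ennreal_mult ennreal_of_nat_eq_real_of_nat)
    qed
    have "emeasure M (F.level 0 (real (2 * Suc n) * S)) \<noteq> 0"
      using pos by (simp add: F.level_def H_def)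
    \<comment> \<open>The whole tower consists of \<open>2 * Suc n\<close> slices of measure
      \<open>c\<close>, so its positive measure lets \<open>c\<close> be cancelled.\<close>
    then have c: "0 < c" unfolding level[OF order_refl] by (auto simp: c_def zero_less_measure_iff measure_nonneg less_le)
    have half: "H / 2 = real (Suc n) * S" "H / 2 - S = real n * S" by (simp_all add: H_def algebra_simps)
    have levels: "emeasure M (F.level 0 (H / 2)) = ennreal (real (Suc n) * c)"
      "emeasure M (F.level 0 (H / 2 - S)) = ennreal (real n * c)"
      unfolding half(2) by (simp_all add: half(1) level del: of_nat_Suc)
    have int: "(\<integral>\<^sup>+y. \<bar>f y\<bar> \<partial>N) = ennreal (\<integral>y. \<bar>f y\<bar> \<partial>N)"
      using f by (intro nn_integral_eq_integral) auto
    have "emeasure M (F.level 0 (H / 2 - S)) * emeasure N (average_exceeds N U s f K \<gamma>)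
        \<le> ennreal (C / \<gamma>) * (emeasure M (F.level 0 (H / 2)) * (\<integral>\<^sup>+y. \<bar>f y\<bar> \<partial>N))"
      using \<open>H > 3\<close> S by (intro F.transferred_inequality_integrated[OF max s N f \<gamma>]) auto
    then have "ennreal (real n * c) * ennreal q \<le> ennreal (C / \<gamma>) * (ennreal (real (Suc n) * c) * ennreal (\<integral>y. \<bar>f y\<bar> \<partial>N))"
      unfolding levels int q_def N.emeasure_eq_measure .
    moreover have nonneg: "0 \<le> C / \<gamma>" "0 \<le> (\<integral>y. \<bar>f y\<bar> \<partial>N)" "0 \<le> q" "0 \<le> real n * c" "0 \<le> real (Suc n) * c"
      using c maximal_inequality_imp_ge_1[OF max] \<gamma> by (simp_all add: q_def)
    ultimately have "ennreal (real n * c * q) \<le> ennreal (C / \<gamma> * (real (Suc n) * c * (\<integral>y. \<bar>f y\<bar> \<partial>N)))"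
      by (simp only: ennreal_mult mult_nonneg_nonneg)
    then have "real n * c * q \<le> C / \<gamma> * (real (Suc n) * c * (\<integral>y. \<bar>f y\<bar> \<partial>N))"
      by (subst (asm) ennreal_le_iff) (intro mult_nonneg_nonneg nonneg)
    then have "c * (real n * q) \<le> c * (real (Suc n) * r)"
      by (simp add: r_def mult_ac)
    then show ?thesis using c by simp
  qed
  \<comment> \<open>Once \<open>n * e\<close> exceeds \<open>r\<close>, the surplus \<open>r\<close>
    in \<open>bound\<close> is absorbed.\<close>
  have "q \<le> r + e" if "e > 0" for e
  proof -
    obtain n :: nat where n: "r / e < real n" using reals_Archimedean2 by blast
    then have "r < real n * e" using that by (simp add: pos_divide_less_eq)
    moreover have "0 < real n" using n r0 that by (smt (verit) divide_nonneg_pos)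
    moreover have "real n * q \<le> real n * r + r" using bound[of n] by (simp add: algebra_simps)
    ultimately have "real n * q < real n * (r + e)" by (simp add: algebra_simps)
    then show ?thesis using \<open>0 < real n\<close> by simp
  qed
  then show ?thesis unfolding q_def[symmetric] r_def[symmetric] by (rule field_le_epsilon)
qed

theorem theorem3p5:
  fixes s :: "nat \<Rightarrow> real" and C :: real
    and M :: "'a measure" and T :: "real \<Rightarrow> 'a \<Rightarrow> 'a"
  assumes "\<And>n. n \<ge> 1 \<Longrightarrow> s n > 0"
    and "dynamical_system M T"
    and "aperiodic M T"
    and "maximal_inequality M T s C"
  shows "\<forall>(N :: 'b measure) U. dynamical_system N U \<longrightarrow> maximal_inequality N U s C"
  unfolding maximal_inequality_def
proof (intro allI impI)
  fix N :: "'b measure" and U and f :: "'b \<Rightarrow> real" and \<gamma> :: real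
  assume N: "dynamical_system N U" and f: "integrable N f" and \<gamma>: "\<gamma> > 0"
  interpret M: dynamical_system M T by (rule assms(2))
  interpret N: dynamical_system N U by (rule N)
  define R where "R = (\<integral>y. \<bar>f y\<bar> \<partial>N)"
  define W where "W = {x \<in> space N. maximal_average U s f x \<ge> ereal \<gamma>}"
  \<comment> \<open>A supremum equal to \<open>\<gamma>\<close> need not be attained, but for
    \<open>\<gamma>' < \<gamma>\<close> some finite average exceeds \<open>\<gamma>'\<close>. The
    truncated sets increase with \<open>K\<close>, so their bound passes to the union.\<close>
  have weaker: "measure N W \<le> C / \<gamma>' * R" if \<gamma>': "0 < \<gamma>'" "\<gamma>' < \<gamma>" for \<gamma>'
  proof -
    let ?A = "\<lambda>K. average_exceeds N U s f K \<gamma>'"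
    have A[measurable]: "?A K \<in> sets N" for K by (rule N.sets_average_exceeds) (use f in simp)
    have "W \<subseteq> (\<Union>K. ?A K)"
    proof
      fix x assume x: "x \<in> W"
      then have "ereal \<gamma>' < maximal_average U s f x"
        using \<gamma>'(2) less_le_trans[of "ereal \<gamma>'" "ereal \<gamma>"] by (auto simp: W_def)
      then obtain n where "n \<ge> 1" "\<gamma>' < (1 / real n) * (\<Sum>i=1..n. f (U (s i) x))"
        unfolding maximal_average_def less_SUP_iff by auto
      then have "x \<in> ?A n" using x by (auto simp: average_exceeds_def W_def intro!: bexI[of _ n])
      then show "x \<in> (\<Union>K. ?A K)" by blast
    qed
    moreover have "measure N (\<Union>K. ?A K) \<le> C / \<gamma>' * R"
    proof (rule LIMSEQ_le_const2)
      show "(\<lambda>K. measure N (?A K)) \<longlonglongrightarrow> measure N (\<Union>K. ?A K)"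
      proof (rule N.finite_Lim_measure_incseq)
        show "range ?A \<subseteq> sets N" using A by blast
        show "incseq ?A" by (auto simp: incseq_def average_exceeds_def intro: order_trans)
      qed
      show "\<exists>K0. \<forall>K\<ge>K0. measure N (?A K) \<le> C / \<gamma>' * R"
        using M.transferred_finite_inequality[OF assms(3,4,1) N f \<gamma>'(1)] by (auto simp: R_def)
    qed
    ultimately show ?thesis
      using N.finite_measure_mono[of W "\<Union>K. ?A K"] by auto
  qed
  \<comment> \<open>The constant is recovered by letting \<open>\<gamma>'\<close> increase to
    \<open>\<gamma>\<close>, where the right side is continuous.\<close>
  have "((\<lambda>\<gamma>'. C / \<gamma>' * R) \<longlongrightarrow> C / \<gamma> * R) (at_left \<gamma>)"
    using \<gamma> by (intro tendsto_intros) auto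
  moreover have "eventually (\<lambda>\<gamma>'. measure N W \<le> C / \<gamma>' * R) (at_left \<gamma>)"
    using \<gamma> weaker by (auto simp: eventually_at_left_field intro!: exI[of _ 0])
  ultimately show "measure N {x \<in> space N. maximal_average U s f x \<ge> ereal \<gamma>} \<le> C / \<gamma> * (\<integral>x. \<bar>f x\<bar> \<partial>N)"
    unfolding W_def[symmetric] R_def[symmetric] by (intro tendsto_lowerbound[of _ _ "at_left \<gamma>"]) auto
qed

end
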